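(* Let $G=\mathrm{GIRG}(n,\beta,w_0,d)$ be a standard GIRG with $\beta=3$ and $d=\omega(\log n)$. Then $\omega(G)=O(1)$ asymptotically almost surely, i.e., for every function $f(n)=\omega(1)$, $\Pr[\omega(G)\ge f(n)]=o(1)$.
   Context: Fix constants $\lambda>0$, $w_0>0$, $\beta>2$. A standard GIRG $\mathrm{GIRG}(n,\beta,w_0,d)$ has $n$ vertices; each vertex $v$ independently receives a weight $w_v$ with $\Pr[w_v\le x]=1-(x/w_0)^{1-\beta}$ for $x\ge w_0$, and independently a position $\mathbf{x}_v$ uniform on the torus $\mathbb{T}^d=[0,1)^d$. The distance is $d(\mathbf{x}_u,\mathbf{x}_v)=\max_{1\le i\le d}|x_{ui}-x_{vi}|_C$ with $|a-b|_C=\min\{|a-b|,1-|a-b|\}$. Distinct $u,v$ are adjacent iff $d(\mathbf{x}_u,\mathbf{x}_v)\le \frac12\big(\frac{\lambda w_uw_v}{n}\big)^{1/d}$. The dimension $d=d(n)$ depends on $n$. $\omega(G)$ is the clique number. *)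

theory Defs
  imports "HOL-Probability.Probability" "HOL-Real_Asymp.Real_Asymp"
begin

definition is_clique :: "'a set \<Rightarrow> 'a set set \<Rightarrow> 'a set \<Rightarrow> bool" where
  "is_clique V E K \<longleftrightarrow> K \<subseteq> V \<and> (\<forall>u\<in>K. \<forall>v\<in>K. u \<noteq> v \<longrightarrow> {u, v} \<in> E)"

definition clique_number :: "'a set \<Rightarrow> 'a set set \<Rightarrow> nat" where
  "clique_number V E = Max {card K | K. is_clique V E K}"

definition pareto_cdf :: "real \<Rightarrow> real \<Rightarrow> real \<Rightarrow> real" where
  "pareto_cdf \<beta> w0 x = (if x < w0 then 0 else 1 - (x / w0) powr (1 - \<beta>))"

definition weight_distr :: "real \<Rightarrow> real \<Rightarrow> real measure" where
  "weight_distr \<beta> w0 = interval_measure (pareto_cdf \<beta> w0)"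

text \<open>A point of the torus is given by its coordinates \<open>0, \<dots>, d - 1\<close>.\<close>

definition torus_distr :: "nat \<Rightarrow> (nat \<Rightarrow> real) measure" where
  "torus_distr d = (\<Pi>\<^sub>M i\<in>{..<d}. uniform_measure lborel {0..<1})"

definition circ_dist :: "real \<Rightarrow> real \<Rightarrow> real" where
  "circ_dist a b = min \<bar>a - b\<bar> (1 - \<bar>a - b\<bar>)"

text \<open>Only meaningful for \<open>d > 0\<close>: the maximum of the empty set is unspecified.\<close>

definition torus_dist :: "nat \<Rightarrow> (nat \<Rightarrow> real) \<Rightarrow> (nat \<Rightarrow> real) \<Rightarrow> real" where
  "torus_dist d x y = Max ((\<lambda>i. circ_dist (x i) (y i)) ` {..<d})"

text \<open>
  The sample space of the random graph on the vertices \<open>0, \<dots>, n - 1\<close>. An outcome \<open>s\<close> assigns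
  to each vertex \<open>v\<close> its weight \<open>fst (s v)\<close> and its position \<open>snd (s v)\<close>; independence is
  expressed by taking product measures. The edge set is a function of the outcome.
\<close>

definition girg :: "nat \<Rightarrow> real \<Rightarrow> real \<Rightarrow> nat \<Rightarrow> (nat \<Rightarrow> real \<times> (nat \<Rightarrow> real)) measure" where
  "girg n \<beta> w0 d = (\<Pi>\<^sub>M v\<in>{..<n}. weight_distr \<beta> w0 \<Otimes>\<^sub>M torus_distr d)"

definition girg_edges ::
  "real \<Rightarrow> nat \<Rightarrow> nat \<Rightarrow> (nat \<Rightarrow> real \<times> (nat \<Rightarrow> real)) \<Rightarrow> nat set set" where
  "girg_edges lam n d s =
     {{u, v} | u v. u < n \<and> v < n \<and> u \<noteq> v \<and>
        torus_dist d (snd (s u)) (snd (s v))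
          \<le> 1/2 * (lam * fst (s u) * fst (s v) / real n) powr (1 / real d)}"

definition girg_clique_number ::
  "real \<Rightarrow> nat \<Rightarrow> nat \<Rightarrow> (nat \<Rightarrow> real \<times> (nat \<Rightarrow> real)) \<Rightarrow> nat" where
  "girg_clique_number lam n d s = clique_number {..<n} (girg_edges lam n d s)"

lemma
  assumes "w0 > 0" "\<beta> > 1"
  shows real_distribution_weight_distr: "real_distribution (weight_distr \<beta> w0)"
    and cdf_weight_distr: "cdf (weight_distr \<beta> w0) = pareto_cdf \<beta> w0"
proof -
  have mono: "pareto_cdf \<beta> w0 x \<le> pareto_cdf \<beta> w0 y" if "x \<le> y" for x y
  proof (cases "x < w0")
    case True
    have "(y / w0) powr (1 - \<beta>) \<le> 1" if "y \<ge> w0"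
    proof -
      have "(y / w0) powr (1 - \<beta>) \<le> (y / w0) powr 0"
        using that assms by (intro powr_mono) auto
      then show ?thesis using that assms by auto
    qed
    then show ?thesis using True by (auto simp: pareto_cdf_def)
  next
    case False
    have "(y / w0) powr (1 - \<beta>) \<le> (x / w0) powr (1 - \<beta>)"
      using that assms False by (intro powr_mono2') (auto simp: divide_right_mono)
    then show ?thesis using False that by (auto simp: pareto_cdf_def)
  qed
  have cont: "continuous (at_right a) (pareto_cdf \<beta> w0)" for a
  proof (cases "a < w0")
    case True
    have "eventually (\<lambda>x. x < w0) (at_right a)"
      using True eventually_at_right_field by blast
    then have "eventually (\<lambda>x. 0 = pareto_cdf \<beta> w0 x) (at_right a)"
      by eventually_elim (simp add: pareto_cdf_def)
    then have "(pareto_cdf \<beta> w0 \<longlongrightarrow> 0) (at_right a)"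
      by (rule Lim_transform_eventually[OF tendsto_const])
    then show ?thesis using True by (simp add: continuous_within pareto_cdf_def)
  next
    case False
    have "((\<lambda>x. 1 - (x / w0) powr (1 - \<beta>)) \<longlongrightarrow> 1 - (a / w0) powr (1 - \<beta>)) (at_right a)"
      using False assms by (auto intro!: tendsto_eq_intros)
    moreover have "eventually (\<lambda>x. 1 - (x / w0) powr (1 - \<beta>) = pareto_cdf \<beta> w0 x) (at_right a)"
      using eventually_at_right_less[of a] False
      by (auto simp: pareto_cdf_def elim!: eventually_mono)
    ultimately have "(pareto_cdf \<beta> w0 \<longlongrightarrow> 1 - (a / w0) powr (1 - \<beta>)) (at_right a)"
      by (rule Lim_transform_eventually)
    then show ?thesis using False by (simp add: continuous_within pareto_cdf_def)
  qed
  have "eventually (\<lambda>x. 0 = pareto_cdf \<beta> w0 x) at_bot"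
    using eventually_gt_at_bot[of w0] by eventually_elim (simp add: pareto_cdf_def)
  then have bot: "(pareto_cdf \<beta> w0 \<longlongrightarrow> 0) at_bot"
    by (rule Lim_transform_eventually[OF tendsto_const])
  have "((\<lambda>x. 1 - (x / w0) powr (1 - \<beta>)) \<longlongrightarrow> 1) at_top"
    using assms by real_asymp
  moreover have "eventually (\<lambda>x. 1 - (x / w0) powr (1 - \<beta>) = pareto_cdf \<beta> w0 x) at_top"
    using eventually_ge_at_top[of w0] by eventually_elim (simp add: pareto_cdf_def)
  ultimately have top: "(pareto_cdf \<beta> w0 \<longlongrightarrow> 1) at_top"
    by (rule Lim_transform_eventually)
  show "real_distribution (weight_distr \<beta> w0)"
    unfolding weight_distr_def by (rule real_distribution_interval_measure[OF mono cont bot top])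
  show "cdf (weight_distr \<beta> w0) = pareto_cdf \<beta> w0"
    unfolding weight_distr_def by (rule cdf_interval_measure[OF mono cont bot])
qed

lemma prob_space_torus_distr: "prob_space (torus_distr d)"
  unfolding torus_distr_def
  by (intro prob_space_PiM prob_space_uniform_measure) auto

lemma prob_space_girg:
  assumes "w0 > 0" "\<beta> > 1"
  shows "prob_space (girg n \<beta> w0 d)"
  unfolding girg_def
  by (intro prob_space_PiM prob_space_pair prob_space_torus_distr
        real_distribution.axioms(1)[OF real_distribution_weight_distr[OF assms]])

lemma measurable_girg_clique_number:
  "girg_clique_number lam n d \<in> girg n \<beta> w0 d \<rightarrow>\<^sub>M count_space UNIV"
proof -
  define M where "M = girg n \<beta> w0 d"
  define A where "A u v s \<longleftrightarrow> torus_dist d (snd (s u)) (snd (s v))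
          \<le> 1/2 * (lam * fst (s u) * fst (s v) / real n) powr (1 / real d)"
    for u v and s :: "nat \<Rightarrow> real \<times> (nat \<Rightarrow> real)"
  have comp: "(\<lambda>s. s v) \<in> M \<rightarrow>\<^sub>M weight_distr \<beta> w0 \<Otimes>\<^sub>M torus_distr d" if "v < n" for v
    unfolding M_def girg_def using that by (intro measurable_component_singleton) auto
  have w: "(\<lambda>s. fst (s v)) \<in> borel_measurable M" if "v < n" for v
    using measurable_fst'[OF comp[OF that]] by (simp add: weight_distr_def cong: measurable_cong_sets)
  have x: "(\<lambda>s. snd (s v) i) \<in> borel_measurable M" if "v < n" "i < d" for v i
  proof -
    have "(\<lambda>x. x i) \<in> torus_distr d \<rightarrow>\<^sub>M uniform_measure lborel {0..<1}"
      unfolding torus_distr_def using that by (intro measurable_component_singleton) auto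
    then have "(\<lambda>x. x i) \<in> borel_measurable (torus_distr d)"
      by (simp cong: measurable_cong_sets)
    from measurable_compose[OF measurable_snd'[OF comp[OF that(1)]] this] show ?thesis .
  qed
  have A: "Measurable.pred M (A u v)" if "u < n" "v < n" for u v
  proof -
    have t: "(\<lambda>s. torus_dist d (snd (s u)) (snd (s v))) \<in> borel_measurable M"
      unfolding torus_dist_def circ_dist_def using that x by (intro borel_measurable_Max) auto
    have "(\<lambda>s. 1/2 * (lam * fst (s u) * fst (s v) / real n) powr (1 / real d)) \<in> borel_measurable M"
      by (intro borel_measurable_times borel_measurable_divide powr_real_measurable
            borel_measurable_const w that)
    from borel_measurable_le[OF t this] show ?thesis
      unfolding A_def[abs_def] pred_def by simp
  qed
  have edge: "{u, v} \<in> girg_edges lam n d s \<longleftrightarrow> u < n \<and> v < n \<and> u \<noteq> v \<and> (A u v s \<or> A v u s)"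
    for u v s unfolding girg_edges_def A_def by (auto simp: doubleton_eq_iff)
  have E: "Measurable.pred M (\<lambda>s. {u, v} \<in> girg_edges lam n d s)" for u v
  proof (cases "u < n \<and> v < n \<and> u \<noteq> v")
    case True
    then have "Measurable.pred M (A u v)" "Measurable.pred M (A v u)"
      using A by auto
    then have "Measurable.pred M (\<lambda>s. A u v s \<or> A v u s)"
      by (rule pred_intros_logic(5))
    then show ?thesis using True unfolding edge by simp
  next
    case False
    then have "(\<lambda>s. {u, v} \<in> girg_edges lam n d s) = (\<lambda>s. False)"
      using edge by blast
    then show ?thesis by (simp only: measurable_const space_count_space UNIV_I)
  qed
  define C where "C s = {K. is_clique {..<n} (girg_edges lam n d s) K}" for s
  have sub: "C s \<subseteq> Pow {..<n}" for s by (auto simp: C_def is_clique_def)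
  have cl: "{s \<in> space M. C s = \<K>} \<in> sets M" for \<K>
  proof (cases "\<K> \<subseteq> Pow {..<n}")
    case True
    have iff: "C s = \<K> \<longleftrightarrow> (\<forall>K\<in>Pow {..<n}. K \<in> \<K> \<longleftrightarrow>
        (\<forall>u\<in>K. \<forall>v\<in>K. u \<noteq> v \<longrightarrow> {u, v} \<in> girg_edges lam n d s))" for s
    proof -
      have "X = Y \<longleftrightarrow> (\<forall>K\<in>P. K \<in> Y \<longleftrightarrow> Q K)"
        if "Y \<subseteq> P" "\<And>K. K \<in> X \<longleftrightarrow> K \<in> P \<and> Q K" for X Y P :: "nat set set" and Q
        using that by auto
      from this[OF True] show ?thesis by (simp add: C_def is_clique_def)
    qed
    have clique: "Measurable.pred M (\<lambda>s. K \<in> \<K> \<longleftrightarrow>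
        (\<forall>u\<in>K. \<forall>v\<in>K. u \<noteq> v \<longrightarrow> {u, v} \<in> girg_edges lam n d s))" if "K \<in> Pow {..<n}" for K
    proof -
      have "finite K" using that by (auto intro: finite_subset)
      then have "Measurable.pred M
          (\<lambda>s. \<forall>u\<in>K. \<forall>v\<in>K. u \<noteq> v \<longrightarrow> {u, v} \<in> girg_edges lam n d s)"
        by (intro pred_intros_finite(3) pred_intros_logic(4) E) simp_all
      moreover have "Measurable.pred M (\<lambda>s. K \<in> \<K>)"
        by (rule measurable_const) simp
      ultimately show ?thesis by (rule pred_intros_logic(6)[rotated])
    qed
    have "finite (Pow {..<n})" by simp
    then have "Measurable.pred M (\<lambda>s. C s = \<K>)"
      unfolding iff by (rule pred_intros_finite(3)[OF _ clique])
    then show ?thesis by (simp only: pred_def)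
  next
    case False
    then have "{s \<in> space M. C s = \<K>} = {}" using sub by auto
    then show ?thesis by (metis sets.empty_sets)
  qed
  have "C \<in> M \<rightarrow>\<^sub>M count_space (Pow (Pow {..<n}))"
    using sub cl by (intro measurable_count_space_eq2[THEN iffD2])
      (auto simp: vimage_def Int_def conj_commute)
  then have "(\<lambda>s. Max (card ` C s)) \<in> M \<rightarrow>\<^sub>M count_space UNIV"
    by (rule measurable_compose) simp
  moreover have "girg_clique_number lam n d = (\<lambda>s. Max (card ` C s))"
    unfolding fun_eq_iff girg_clique_number_def clique_number_def C_def image_Collect by blast
  ultimately show ?thesis by (simp only: M_def)
qed

end

theory Submission
  imports Defs
begin

text \<open>
  Call a vertex heavy if its weight exceeds \<open>c \<surd>n\<close>. As \<open>\<beta> = 3\<close>, the expected number of heavy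
  vertices is at most \<open>w0\<^sup>2 / c\<^sup>2\<close>, so a clique that is much larger contains five light vertices.
  It remains to bound the expected number of light 5-cliques.

  Condition on the weights and put \<open>p\<^sub>u\<^sub>v = lam w\<^sub>u w\<^sub>v / n\<close>. The \<open>d\<close> coordinates are independent,
  and in one coordinate the pair \<open>u, v\<close> is too far apart with probability
  \<open>\<epsilon>\<^sub>u\<^sub>v = 1 - p\<^sub>u\<^sub>v powr (1/d)\<close>. These events are pairwise independent, so by the second
  Bonferroni inequality none of them occurs with probability at most \<open>1 - S + S\<^sup>2/2\<close>, where \<open>S\<close>
  is the sum of the \<open>\<epsilon>\<^sub>u\<^sub>v\<close>. Since \<open>d\<close> dominates \<open>ln n\<close>, all \<open>\<epsilon>\<^sub>u\<^sub>v\<close> are uniformly small and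
  the \<open>d\<close>-th power is at most the product of the \<open>p\<^sub>u\<^sub>v powr (3/4)\<close>. Each of the five vertices lies
  in four pairs and thus contributes the cube of \<open>w\<^sub>v \<surd>(lam/n)\<close>; the truncated third moment of
  the weights makes the expected number of light 5-cliques \<open>O(c\<^sup>5)\<close>. Letting \<open>c\<close> tend to \<open>0\<close>
  slowly compared with \<open>f\<close> finishes the proof.
\<close>

subsection \<open>Integration over products of product measures\<close>

text \<open>A measure on a finite product is determined by its values on boxes. For fixed
  \<open>x\<close>, the section of the preimage of a box is again a box, so its measure factorises
  over \<open>I\<close> and the integral over \<open>x\<close> splits. In the application all
  weights are drawn first and all positions afterwards.\<close>

lemma PiM_pair_eq_distr:
  assumes "\<And>i. sigma_finite_measure (M i)" and "\<And>i. sigma_finite_measure (N i)" and I: "finite I"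
  shows "(\<Pi>\<^sub>M i\<in>I. M i \<Otimes>\<^sub>M N i) =
    distr (PiM I M \<Otimes>\<^sub>M PiM I N) (\<Pi>\<^sub>M i\<in>I. M i \<Otimes>\<^sub>M N i) (\<lambda>(x, y). \<lambda>i\<in>I. (x i, y i))"
proof -
  interpret M: product_sigma_finite M using assms(1) by (rule product_sigma_finite.intro)
  interpret N: product_sigma_finite N using assms(2) by (rule product_sigma_finite.intro)
  interpret PN: sigma_finite_measure "PiM I N" by (rule N.sigma_finite[OF I])
  have pair: "sigma_finite_measure (M i \<Otimes>\<^sub>M N i)" for i
    by (rule sigma_finite_pair_measure) fact+
  interpret Q: product_sigma_finite "\<lambda>i. M i \<Otimes>\<^sub>M N i" using pair by (rule product_sigma_finite.intro)
  let ?f = "\<lambda>(x, y). \<lambda>i\<in>I. (x i, y i)"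
  have f[measurable]: "?f \<in> PiM I M \<Otimes>\<^sub>M PiM I N \<rightarrow>\<^sub>M (\<Pi>\<^sub>M i\<in>I. M i \<Otimes>\<^sub>M N i)"
    by measurable
  show ?thesis
  proof (rule Q.PiM_eqI[OF I, symmetric])
    fix A assume A: "\<And>i. i \<in> I \<Longrightarrow> A i \<in> sets (M i \<Otimes>\<^sub>M N i)"
    \<comment> \<open>\<open>B\<close> is intersected with the space of the product, whereas the
      sections in \<open>cut\<close> are not; this fact supplies the missing membership.\<close>
    have A_space: "y \<in> space (N i)" if "i \<in> I" "(x, y) \<in> A i" for i x y
      using sets.sets_into_space[OF A[OF that(1)]] that(2) by (auto simp: space_pair_measure)
    have box: "Pi\<^sub>E I A \<in> sets (\<Pi>\<^sub>M i\<in>I. M i \<Otimes>\<^sub>M N i)"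
      by (rule sets_PiM_I_finite[OF I A])
    define B where "B = ?f -` (Pi\<^sub>E I A) \<inter> space (PiM I M \<Otimes>\<^sub>M PiM I N)"
    have B: "B \<in> sets (PiM I M \<Otimes>\<^sub>M PiM I N)"
      unfolding B_def by (rule measurable_sets[OF f box])
    have cut: "Pair x -` B = (\<Pi>\<^sub>E i\<in>I. Pair (x i) -` A i)" if "x \<in> space (PiM I M)" for x
      using that
      by (auto simp: B_def space_pair_measure space_PiM PiE_iff extensional_def dest: A_space)
    have "emeasure (distr (PiM I M \<Otimes>\<^sub>M PiM I N) (\<Pi>\<^sub>M i\<in>I. M i \<Otimes>\<^sub>M N i) ?f) (Pi\<^sub>E I A)
        = emeasure (PiM I M \<Otimes>\<^sub>M PiM I N) B"
      unfolding B_def by (rule emeasure_distr[OF f box])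
    also have "\<dots> = (\<integral>\<^sup>+x. emeasure (PiM I N) (Pair x -` B) \<partial>PiM I M)"
      by (rule PN.emeasure_pair_measure_alt[OF B])
    also have "\<dots> = (\<integral>\<^sup>+x. (\<Prod>i\<in>I. emeasure (N i) (Pair (x i) -` A i)) \<partial>PiM I M)"
      by (intro nn_integral_cong, subst cut)
        (auto intro!: N.emeasure_PiM[OF I] sets_Pair1[OF A])
    also have "\<dots> = (\<Prod>i\<in>I. \<integral>\<^sup>+x. emeasure (N i) (Pair x -` A i) \<partial>M i)"
      by (rule M.product_nn_integral_prod[OF I])
        (auto intro!: sigma_finite_measure.measurable_emeasure_Pair[OF assms(2)] A)
    also have "\<dots> = (\<Prod>i\<in>I. emeasure (M i \<Otimes>\<^sub>M N i) (A i))"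
      by (intro prod.cong refl)
        (simp add: sigma_finite_measure.emeasure_pair_measure_alt[OF assms(2)] A)
    finally show "emeasure (distr (PiM I M \<Otimes>\<^sub>M PiM I N) (\<Pi>\<^sub>M i\<in>I. M i \<Otimes>\<^sub>M N i) ?f) (Pi\<^sub>E I A)
        = (\<Prod>i\<in>I. emeasure (M i \<Otimes>\<^sub>M N i) (A i))" .
  qed simp
qed

text \<open>This is conditioning on the weights: \<open>M\<close> will be the law of the weights,
  \<open>N\<close> the law of the positions, and the inner integral the conditional probability
  given the weights \<open>x\<close>.\<close>

lemma nn_integral_PiM_pair:
  assumes "\<And>i. sigma_finite_measure (M i)" and "\<And>i. sigma_finite_measure (N i)" and I: "finite I"
    and f[measurable]: "f \<in> borel_measurable (\<Pi>\<^sub>M i\<in>I. M i \<Otimes>\<^sub>M N i)"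
  shows "(\<integral>\<^sup>+s. f s \<partial>(\<Pi>\<^sub>M i\<in>I. M i \<Otimes>\<^sub>M N i)) =
    (\<integral>\<^sup>+x. \<integral>\<^sup>+y. f (\<lambda>i\<in>I. (x i, y i)) \<partial>PiM I N \<partial>PiM I M)"
proof -
  interpret N: product_sigma_finite N using assms(2) by (rule product_sigma_finite.intro)
  interpret PN: sigma_finite_measure "PiM I N" by (rule N.sigma_finite[OF I])
  show ?thesis
    by (subst PiM_pair_eq_distr[OF assms(1,2) I])
      (simp add: nn_integral_distr PN.nn_integral_fst[symmetric])
qed

text \<open>Positions form a matrix with one row per vertex and one column per coordinate. The
  measure is built row by row, and the lemma makes the columns independent. The induction adds one
  row \<open>v\<close>: each factor involves only one entry \<open>y j\<close> of that row, so the
  integral over the row splits.\<close>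

lemma nn_integral_PiM_PiM_prod:
  assumes U: "sigma_finite_measure U" and "finite I" and J: "finite J"
    and "\<And>j. j \<in> J \<Longrightarrow> g j \<in> borel_measurable (\<Pi>\<^sub>M i\<in>I. U)"
  shows "(\<integral>\<^sup>+x. (\<Prod>j\<in>J. g j (\<lambda>i\<in>I. x i j)) \<partial>(\<Pi>\<^sub>M i\<in>I. \<Pi>\<^sub>M j\<in>J. U)) =
    (\<Prod>j\<in>J. \<integral>\<^sup>+z. g j z \<partial>(\<Pi>\<^sub>M i\<in>I. U))"
  using assms(2,4)
proof (induction I arbitrary: g)
  case empty
  then show ?case by (simp add: PiM_empty nn_integral_count_space_finite)
next
  case (insert v I)
  interpret U: sigma_finite_measure U by fact
  interpret PU: product_sigma_finite "\<lambda>_. U" by standard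
  interpret T: sigma_finite_measure "\<Pi>\<^sub>M j\<in>J. U" by (rule PU.sigma_finite[OF J])
  interpret PT: product_sigma_finite "\<lambda>_. \<Pi>\<^sub>M j\<in>J. U" by standard
  note g[measurable] = insert.prems
  have col: "(\<lambda>x. \<lambda>i\<in>I'. x i j) \<in> (\<Pi>\<^sub>M i\<in>I'. \<Pi>\<^sub>M j\<in>J. U) \<rightarrow>\<^sub>M (\<Pi>\<^sub>M i\<in>I'. U)"
    if "j \<in> J" for j and I' :: "'b set"
  proof (rule measurable_restrict)
    fix i assume "i \<in> I'"
    show "(\<lambda>x. x i j) \<in> (\<Pi>\<^sub>M i\<in>I'. \<Pi>\<^sub>M j\<in>J. U) \<rightarrow>\<^sub>M U"
      by (rule measurable_compose[OF measurable_component_singleton[OF \<open>i \<in> I'\<close>]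
            measurable_component_singleton[OF that]])
  qed
  have upd: "(\<lambda>z. g j ((fst z)(v := snd z))) \<in> borel_measurable ((\<Pi>\<^sub>M i\<in>I. U) \<Otimes>\<^sub>M U)" if "j \<in> J" for j
    using measurable_compose[OF measurable_add_dim g[OF that]] by (simp add: case_prod_beta' fun_upd_def)
  have upd1: "(\<lambda>t. g j (z(v := t))) \<in> borel_measurable U"
    if "j \<in> J" "z \<in> space (\<Pi>\<^sub>M i\<in>I. U)" for j z
    using measurable_compose[OF measurable_Pair1'[OF that(2)] upd[OF that(1)]] by simp
  have g_col: "(\<lambda>x. g j (\<lambda>i\<in>insert v I. x i j)) \<in> borel_measurable (\<Pi>\<^sub>M i\<in>insert v I. \<Pi>\<^sub>M j\<in>J. U)"
    if "j \<in> J" for j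
    by (rule measurable_compose[OF col[OF that] g[OF that]])
  have "(\<integral>\<^sup>+x. (\<Prod>j\<in>J. g j (\<lambda>i\<in>insert v I. x i j)) \<partial>(\<Pi>\<^sub>M i\<in>insert v I. \<Pi>\<^sub>M j\<in>J. U))
      = (\<integral>\<^sup>+x. \<integral>\<^sup>+y. (\<Prod>j\<in>J. g j (\<lambda>i\<in>insert v I. (x(v := y)) i j)) \<partial>(\<Pi>\<^sub>M j\<in>J. U) \<partial>(\<Pi>\<^sub>M i\<in>I. \<Pi>\<^sub>M j\<in>J. U))"
    by (rule PT.product_nn_integral_insert[OF insert.hyps])
      (intro borel_measurable_prod_ennreal g_col)
  also have "\<dots> = (\<integral>\<^sup>+x. \<integral>\<^sup>+y. (\<Prod>j\<in>J. g j ((\<lambda>i\<in>I. x i j)(v := y j))) \<partial>(\<Pi>\<^sub>M j\<in>J. U) \<partial>(\<Pi>\<^sub>M i\<in>I. \<Pi>\<^sub>M j\<in>J. U))"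
  proof -
    have "(\<lambda>i\<in>insert v I. (x(v := y)) i j) = (\<lambda>i\<in>I. x i j)(v := y j)" for x j and y :: "'c \<Rightarrow> 'a"
      using insert.hyps by (auto simp: fun_eq_iff)
    then show ?thesis by (simp only:)
  qed
  also have "\<dots> = (\<integral>\<^sup>+x. (\<Prod>j\<in>J. \<integral>\<^sup>+t. g j ((\<lambda>i\<in>I. x i j)(v := t)) \<partial>U) \<partial>(\<Pi>\<^sub>M i\<in>I. \<Pi>\<^sub>M j\<in>J. U))"
    by (intro nn_integral_cong PU.product_nn_integral_prod J upd1 measurable_space[OF col])
  also have "\<dots> = (\<Prod>j\<in>J. \<integral>\<^sup>+z. \<integral>\<^sup>+t. g j (z(v := t)) \<partial>U \<partial>(\<Pi>\<^sub>M i\<in>I. U))"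
    by (rule insert.IH)
      (intro U.borel_measurable_nn_integral_fst[OF upd, simplified])
  also have "\<dots> = (\<Prod>j\<in>J. \<integral>\<^sup>+z. g j z \<partial>(\<Pi>\<^sub>M i\<in>insert v I. U))"
    by (intro prod.cong refl PU.product_nn_integral_insert[symmetric] insert.hyps g)
  finally show ?case .
qed

subsection \<open>Pairwise distances in one coordinate\<close>

text \<open>With \<open>N\<close> the number of events that occur, the indicator of
  \<open>N = 0\<close> is at most \<open>1 - N + N (N - 1) / 2\<close>. The expectation of the
  right-hand side involves only intersections of two events, so pairwise independence suffices. In
  the expectation of \<open>Q\<close>, the square of \<open>N\<close>, the diagonal contributes
  \<open>S\<close> and the rest at most \<open>S\<^sup>2\<close>.\<close>

lemma (in prob_space) prob_none_le_pairwise_indep: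
  assumes F: "finite F" and E: "\<And>e. e \<in> F \<Longrightarrow> E e \<in> events"
    and indep: "\<And>e e'. e \<in> F \<Longrightarrow> e' \<in> F \<Longrightarrow> e \<noteq> e' \<Longrightarrow> prob (E e \<inter> E e') = prob (E e) * prob (E e')"
  defines "S \<equiv> (\<Sum>e\<in>F. prob (E e))"
  shows "prob (space M - (\<Union>e\<in>F. E e)) \<le> 1 - S + S\<^sup>2 / 2"
proof -
  define N :: "'a \<Rightarrow> real" where "N z = (\<Sum>e\<in>F. indicator (E e) z)" for z
  define Q :: "'a \<Rightarrow> real" where "Q z = (\<Sum>e\<in>F. \<Sum>e'\<in>F. indicator (E e \<inter> E e') z)" for z
  have N_card: "N z = real (card {e\<in>F. z \<in> E e})" for z
    using F by (simp add: N_def indicator_def sum.If_cases Int_def)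
  have Q_eq: "Q z = (N z)\<^sup>2" for z
    by (simp add: Q_def N_def power2_eq_square sum_product indicator_inter_arith)
  have N: "integrable M N" "expectation N = S"
    unfolding N_def S_def using E by (auto simp: integral_sum emeasure_eq_measure)
  have Q: "integrable M Q" "expectation Q = (\<Sum>e\<in>F. \<Sum>e'\<in>F. prob (E e \<inter> E e'))"
    unfolding Q_def using E by (auto simp: integral_sum emeasure_eq_measure)
  have "(\<Union>e\<in>F. E e) \<in> events" using E F by (rule sets.finite_UN[rotated])
  then have none: "space M - (\<Union>e\<in>F. E e) \<in> events" by (rule sets.compl_sets)
  have "prob (space M - (\<Union>e\<in>F. E e)) = expectation (indicator (space M - (\<Union>e\<in>F. E e)))"
    by (simp add: Int_absorb2 Diff_subset)
  also have "\<dots> \<le> expectation (\<lambda>z. 1 - N z + (Q z - N z) / 2)"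
  proof (rule integral_mono)
    fix z assume "z \<in> space M"
    show "indicator (space M - (\<Union>e\<in>F. E e)) z \<le> 1 - N z + (Q z - N z) / 2"
    proof (cases "N z = 0")
      case True then show ?thesis by (simp add: Q_eq indicator_def)
    next
      case False
      then have "(\<exists>e\<in>F. z \<in> E e)" by (auto simp: N_def indicator_def intro: ccontr)
      then have "indicator (space M - (\<Union>e\<in>F. E e)) z = (0::real)" by auto
      \<comment> \<open>The product is negative only strictly between 1 and 2, which contains no
        value of the integer \<open>N z\<close>.\<close>
      moreover have "0 \<le> (1 - N z) * (2 - N z)"
      proof -
        obtain k where "N z = real k" by (simp add: N_card)
        moreover from this False have "k = 1 \<or> k \<ge> 2" by (cases k) auto
        ultimately show ?thesis by (auto simp: zero_le_mult_iff)
      qed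
      ultimately show ?thesis by (simp add: Q_eq power2_eq_square field_simps)
    qed
  qed (use none N Q in \<open>auto simp: emeasure_eq_measure\<close>)
  also have "\<dots> = 1 - S + (expectation Q - S) / 2"
    using N Q(1) by (simp add: prob_space)
  also have "expectation Q \<le> S + S\<^sup>2"
  proof -
    have "(\<Sum>e'\<in>F. prob (E e \<inter> E e')) \<le> prob (E e) + prob (E e) * S" if e: "e \<in> F" for e
    proof -
      have "(\<Sum>e'\<in>F. prob (E e \<inter> E e')) = prob (E e) + (\<Sum>e'\<in>F - {e}. prob (E e \<inter> E e'))"
        using F e by (simp add: sum.remove)
      also have "(\<Sum>e'\<in>F - {e}. prob (E e \<inter> E e')) = (\<Sum>e'\<in>F - {e}. prob (E e) * prob (E e'))"
        using e by (intro sum.cong indep) auto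
      also have "\<dots> \<le> (\<Sum>e'\<in>F. prob (E e) * prob (E e'))"
        using F by (intro sum_mono2) auto
      finally show ?thesis by (simp add: S_def sum_distrib_left)
    qed
    then have "expectation Q \<le> (\<Sum>e\<in>F. prob (E e) + prob (E e) * S)"
      unfolding Q by (intro sum_mono)
    also have "\<dots> = S + S\<^sup>2"
      by (simp add: sum.distrib sum_distrib_right[symmetric] S_def power2_eq_square)
    finally show ?thesis .
  qed
  finally show ?thesis by simp
qed

abbreviation (input) unif01 :: "real measure" where
  "unif01 \<equiv> uniform_measure lborel {0..<1}"

lemma prob_space_unif01: "prob_space unif01"
  by (rule prob_space_uniform_measure) auto

text \<open>On a circle of length 1, the points within distance \<open>t\<close> of \<open>a\<close>
  form an arc of length \<open>2 * t\<close>, wherever \<open>a\<close> lies.\<close>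

lemma emeasure_unif01_circ_dist_gt:
  assumes a: "0 \<le> a" "a < 1" and t: "0 \<le> t" "t \<le> 1/2"
  shows "emeasure unif01 {z. t < circ_dist a z} = ennreal (1 - 2 * t)"
proof -
  have "emeasure unif01 {z. t < circ_dist a z} = emeasure lborel ({0..<1} \<inter> {z. t < circ_dist a z})"
    by (subst emeasure_uniform_measure) (auto simp: circ_dist_def divide_ennreal_def)
  also have "{0..<1} \<inter> {z. t < circ_dist a z} =
    {z. a + t < z \<and> z < min 1 (a + 1 - t)} \<union> {z. max 0 (a - 1 + t) \<le> z \<and> z < a - t \<and> a - 1 + t < z}"
    using a t by (auto simp: circ_dist_def)
  also have "emeasure lborel \<dots> = ennreal (1 - 2 * t)"
  proof -
    \<comment> \<open>The arc of radius \<open>t\<close> around \<open>a\<close> passes below 0,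
      stays inside the unit interval, or reaches 1. Only in the middle case is its complement two
      intervals.\<close>
    consider "a < t" | "t \<le> a" "a < 1 - t" | "1 - t \<le> a" by linarith
    then show ?thesis
    proof cases
      case 1
      then have "{z. a + t < z \<and> z < min 1 (a + 1 - t)} \<union>
          {z. max 0 (a - 1 + t) \<le> z \<and> z < a - t \<and> a - 1 + t < z} = {a + t<..<a + 1 - t}"
        using a t by auto
      then show ?thesis using 1 a t by simp
    next
      case 2
      then have eq: "{z. a + t < z \<and> z < min 1 (a + 1 - t)} \<union>
          {z. max 0 (a - 1 + t) \<le> z \<and> z < a - t \<and> a - 1 + t < z} = {a + t<..<1} \<union> {0..<a - t}"
        using a t by auto
      have "emeasure lborel ({a + t<..<1} \<union> {0..<a - t}) = ennreal (1 - a - t) + ennreal (a - t)"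
        using 2 a t by (subst plus_emeasure[symmetric]) auto
      then show ?thesis using 2 a t unfolding eq by (simp flip: ennreal_plus)
    next
      case 3
      then have "{z. a + t < z \<and> z < min 1 (a + 1 - t)} \<union>
          {z. max 0 (a - 1 + t) \<le> z \<and> z < a - t \<and> a - 1 + t < z} = {a - 1 + t<..<a - t}"
        using a t by auto
      then show ?thesis using 3 a t by simp
    qed
  qed
  finally show ?thesis .
qed

lemma circ_dist_commute: "circ_dist a b = circ_dist b a"
  by (simp add: circ_dist_def abs_minus_commute)

text \<open>Integrate over the position of \<open>v\<close> first. \<open>Q\<close> does not see
  that position, and whatever the position of \<open>u\<close>, the inner probability is
  \<open>1 - 2 * t\<close>. Thus the event is independent of \<open>Q\<close> even if
  \<open>Q\<close> depends on \<open>u\<close>.\<close>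

lemma prob_PiM_unif01_circ_dist_gt:
  assumes I: "finite I" and uv: "u \<in> I" "v \<in> I" "u \<noteq> v" and t: "0 \<le> t" "t \<le> 1/2"
    and Q: "Q \<in> sets (\<Pi>\<^sub>M i\<in>I. unif01)"
    and inv: "\<And>z y. z \<in> space (\<Pi>\<^sub>M i\<in>I. unif01) \<Longrightarrow> z(v := y) \<in> Q \<longleftrightarrow> z \<in> Q"
  defines "P \<equiv> \<Pi>\<^sub>M i\<in>I. unif01"
  shows "measure P (Q \<inter> {z \<in> space P. t < circ_dist (z u) (z v)}) = measure P Q * (1 - 2 * t)"
proof -
  interpret U: prob_space unif01 by (rule prob_space_unif01)
  interpret PU: product_sigma_finite "\<lambda>_. unif01" by standard
  interpret P: prob_space P unfolding P_def by (intro prob_space_PiM prob_space_unif01)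
  define I' where "I' = I - {v}"
  have I': "finite I'" "v \<notin> I'" "insert v I' = I" "u \<in> I'"
    using I uv by (auto simp: I'_def)
  define P' where "P' = (\<Pi>\<^sub>M i\<in>I'. unif01)"
  define E where "E = {z \<in> space P. t < circ_dist (z u) (z v)}"
  have QP[measurable]: "Q \<in> sets P" using Q by (simp add: P_def)
  have comp: "(\<lambda>z. z i) \<in> borel_measurable P" if "i \<in> I" for i
    using measurable_component_singleton[OF that, of "\<lambda>_. unif01"]
    by (simp add: P_def cong: measurable_cong_sets)
  have E[measurable]: "E \<in> sets P"
    using comp[OF uv(1)] comp[OF uv(2)] unfolding E_def circ_dist_def by measurable
  have insert: "(\<integral>\<^sup>+z. h z \<partial>P) = (\<integral>\<^sup>+x. \<integral>\<^sup>+y. h (x(v := y)) \<partial>unif01 \<partial>P')"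
    if "h \<in> borel_measurable P" for h
    using PU.product_nn_integral_insert[OF I'(1,2), of h] that
    by (simp add: P_def P'_def I'(3))
  have upd: "x(v := y) \<in> space P" if "x \<in> space P'" for x y
    using that uv by (auto simp: P_def P'_def I'_def space_PiM PiE_iff extensional_def)
  \<comment> \<open>The value 0 is an arbitrary reference point for coordinate \<open>v\<close>; it
    makes the indicator of \<open>Q\<close> constant in the inner integral.\<close>
  have Qupd: "indicator Q (x(v := y)) = (indicator Q (x(v := 0)) :: ennreal)" if "x \<in> space P'" for x y
    using inv[of "x(v := 0)" y] upd[OF that] by (simp add: P_def indicator_def)
  have sec: "{y. t < circ_dist a y} \<in> sets unif01" for a
    by (simp add: circ_dist_def)
  \<comment> \<open>The underlying space of the uniform measure is the whole real line, so the range
    condition on \<open>x u\<close> holds only almost everywhere.\<close>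
  have "AE y in unif01. y \<in> {0..<1}"
    by (rule AE_uniform_measureI) auto
  then have AE: "AE x in P'. x u \<in> {0..<1}"
    unfolding P'_def by (intro AE_PiM_component prob_space_unif01 I')
  have "emeasure P (Q \<inter> E) = (\<integral>\<^sup>+z. indicator Q z * indicator E z \<partial>P)"
    by (simp flip: indicator_inter_arith)
  also have "\<dots> = (\<integral>\<^sup>+x. \<integral>\<^sup>+y. indicator Q (x(v := y)) * indicator E (x(v := y)) \<partial>unif01 \<partial>P')"
    by (rule insert) measurable
  also have "\<dots> = (\<integral>\<^sup>+x. \<integral>\<^sup>+y. indicator Q (x(v := 0)) * indicator {y. t < circ_dist (x u) y} y \<partial>unif01 \<partial>P')"
  proof (intro nn_integral_cong)
    fix x y assume x: "x \<in> space P'"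
    show "indicator Q (x(v := y)) * indicator E (x(v := y)) =
        (indicator Q (x(v := 0)) * indicator {y. t < circ_dist (x u) y} y :: ennreal)"
      unfolding Qupd[OF x, of y] using upd[OF x, of y] uv by (auto simp: E_def indicator_def)
  qed
  also have "\<dots> = (\<integral>\<^sup>+x. indicator Q (x(v := 0)) * emeasure unif01 {y. t < circ_dist (x u) y} \<partial>P')"
    by (intro nn_integral_cong nn_integral_cmult_indicator sec)
  also have "\<dots> = (\<integral>\<^sup>+x. \<integral>\<^sup>+y. indicator Q (x(v := y)) * ennreal (1 - 2 * t) \<partial>unif01 \<partial>P')"
  proof (intro nn_integral_cong_AE, use AE AE_space in eventually_elim)
    fix x assume x: "x u \<in> {0..<1}" "x \<in> space P'"
    show "indicator Q (x(v := 0)) * emeasure unif01 {y. t < circ_dist (x u) y} =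
        (\<integral>\<^sup>+y. indicator Q (x(v := y)) * ennreal (1 - 2 * t) \<partial>unif01)"
    proof -
      have "(\<integral>\<^sup>+y. indicator Q (x(v := y)) * ennreal (1 - 2 * t) \<partial>unif01) =
          (\<integral>\<^sup>+y. indicator Q (x(v := 0)) * ennreal (1 - 2 * t) \<partial>unif01)"
      proof (rule nn_integral_cong)
        fix y show "indicator Q (x(v := y)) * ennreal (1 - 2 * t) =
            indicator Q (x(v := 0)) * ennreal (1 - 2 * t)"
          unfolding Qupd[OF x(2), of y] ..
      qed
      also have "\<dots> = indicator Q (x(v := 0)) * ennreal (1 - 2 * t)"
        by (subst nn_integral_const, subst U.emeasure_space_1) simp
      finally show ?thesis
        using x t by (simp add: emeasure_unif01_circ_dist_gt)
    qed
  qed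
  also have "\<dots> = (\<integral>\<^sup>+z. indicator Q z * ennreal (1 - 2 * t) \<partial>P)"
    by (rule insert[symmetric]) measurable
  also have "\<dots> = emeasure P Q * ennreal (1 - 2 * t)"
    by (simp add: nn_integral_multc)
  finally have "ennreal (measure P (Q \<inter> E)) = ennreal (measure P Q * (1 - 2 * t))"
    using t by (simp add: P.emeasure_eq_measure ennreal_mult)
  then show ?thesis
    using t by (simp add: E_def)
qed

text \<open>Around a cycle of vertices the distances are in general not mutually independent, so the
  probability is not simply a product. Two different pairs, however, share at most one vertex, and
  this gives the pairwise independence needed for the Bonferroni bound.\<close>

lemma prob_PiM_unif01_all_circ_dist_le:
  fixes I :: "nat set"
  assumes I: "finite I" and F: "\<And>u v. (u, v) \<in> F \<Longrightarrow> u \<in> I \<and> v \<in> I \<and> u < v"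
    and t: "\<And>e. e \<in> F \<Longrightarrow> 0 \<le> t e \<and> t e \<le> 1/2"
  defines "P \<equiv> \<Pi>\<^sub>M i\<in>I. unif01" and "S \<equiv> \<Sum>e\<in>F. 1 - 2 * t e"
  shows "measure P {z \<in> space P. \<forall>e\<in>F. circ_dist (z (fst e)) (z (snd e)) \<le> t e} \<le> 1 - S + S\<^sup>2 / 2"
proof -
  interpret P: prob_space P unfolding P_def by (intro prob_space_PiM prob_space_unif01)
  have "F \<subseteq> I \<times> I" using F by auto
  then have fin: "finite F" using I by (metis finite_SigmaI finite_subset)
  define E where "E e = {z \<in> space P. t e < circ_dist (z (fst e)) (z (snd e))}" for e
  have comp: "(\<lambda>z. z i) \<in> borel_measurable P" if "i \<in> I" for i
    using measurable_component_singleton[OF that, of "\<lambda>_. unif01"]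
    by (simp add: P_def cong: measurable_cong_sets)
  have E: "E e \<in> sets P" if "e \<in> F" for e
  proof -
    have "fst e \<in> I" "snd e \<in> I" using F[of "fst e" "snd e"] that by auto
    from this[THEN comp] show ?thesis unfolding E_def circ_dist_def by measurable
  qed
  have space_upd: "z(i := y) \<in> space P" if "z \<in> space P" "i \<in> I" for z i y
    using that by (auto simp: P_def space_PiM PiE_iff extensional_def)
  \<comment> \<open>Taking \<open>Q\<close> to be the whole space yields \<open>prob_E\<close>;
    taking \<open>Q = E e\<close> for another pair yields \<open>indep\<close>. Either endpoint may
    serve as \<open>x\<close> because \<open>circ_dist\<close> is symmetric.\<close>
  have step: "measure P (Q \<inter> E e) = measure P Q * (1 - 2 * t e)"
    if e: "e \<in> F" "x = fst e \<or> x = snd e" and Q: "Q \<in> sets P"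
      "\<And>z y. z \<in> space P \<Longrightarrow> z(x := y) \<in> Q \<longleftrightarrow> z \<in> Q" for e x Q
  proof -
    obtain u v where uv: "e = (u, v)" by (cases e)
    note Fe = F[OF e(1)[unfolded uv]]
    show ?thesis
    proof (cases "x = v")
      case True
      show ?thesis
        using prob_PiM_unif01_circ_dist_gt[OF I, of u v "t e" Q] Fe t[OF e(1)] Q True
        by (simp add: uv E_def flip: P_def)
    next
      case False
      then have "x = u" using e uv by auto
      then show ?thesis
        using prob_PiM_unif01_circ_dist_gt[OF I, of v u "t e" Q] Fe t[OF e(1)] Q
        by (simp add: uv E_def circ_dist_commute[of "_ u"] flip: P_def)
    qed
  qed
  have prob_E: "measure P (E e) = 1 - 2 * t e" if "e \<in> F" for e
    using step[OF that, of "snd e" "space P"] E[OF that] F[of "fst e" "snd e"] that space_upd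
    by (auto simp: P.prob_space Int_absorb1 sets.sets_into_space)
  have indep: "measure P (E e \<inter> E e') = measure P (E e) * measure P (E e')"
    if e: "e \<in> F" "e' \<in> F" "e \<noteq> e'" for e e'
  proof -
    \<comment> \<open>\<open>E e\<close> does not depend on the position of some endpoint \<open>x\<close> of \<open>e'\<close>, and given all other
      positions \<open>E e'\<close> has the same probability.\<close>
    obtain x where x: "x = fst e' \<or> x = snd e'" "x \<noteq> fst e" "x \<noteq> snd e"
    proof -
      have "fst e < snd e" "fst e' < snd e'" "fst e \<noteq> fst e' \<or> snd e \<noteq> snd e'"
        using F[of "fst e" "snd e"] F[of "fst e'" "snd e'"] e by (auto simp: prod_eq_iff)
      then show ?thesis using that[of "fst e'"] that[of "snd e'"] by linarith
    qed
    have "x \<in> I" using x F[of "fst e'" "snd e'"] e by auto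
    then have "z(x := y) \<in> E e \<longleftrightarrow> z \<in> E e" if "z \<in> space P" for z y
      using x(2,3) that space_upd[OF that] by (simp add: E_def)
    then show ?thesis
      using step[OF e(2) x(1) E[OF e(1)]] prob_E[OF e(2)] by simp
  qed
  have "{z \<in> space P. \<forall>e\<in>F. circ_dist (z (fst e)) (z (snd e)) \<le> t e} = space P - (\<Union>e\<in>F. E e)"
    by (auto simp: E_def not_less)
  moreover have "S = (\<Sum>e\<in>F. measure P (E e))"
    unfolding S_def by (intro sum.cong) (simp_all add: prob_E)
  ultimately show ?thesis
    using P.prob_none_le_pairwise_indep[OF fin E indep] by simp
qed

section \<open>Products over pairs and the estimate of the \<open>d\<close>-th power\<close>

text \<open>Each vertex lies in \<open>card K - 1\<close> pairs. Swapping the pairs behind the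
  factor \<open>y v\<close> turns the two products into a single one of \<open>y u\<close> over all
  off-diagonal pairs of \<open>K\<close>.\<close>

lemma prod_less_pairs:
  fixes y :: "nat \<Rightarrow> real"
  assumes K: "finite K"
  shows "(\<Prod>(u, v)\<in>{(u, v). u \<in> K \<and> v \<in> K \<and> u < v}. y u * y v) = (\<Prod>u\<in>K. y u ^ (card K - 1))"
proof -
  let ?F = "{(u, v). u \<in> K \<and> v \<in> K \<and> u < v}" and ?G = "{(u, v). u \<in> K \<and> v \<in> K \<and> v < u}"
  have "?F \<subseteq> K \<times> K" "?G \<subseteq> K \<times> K" by auto
  then have fin: "finite ?F" "finite ?G" using K by (meson finite_SigmaI finite_subset)+
  have "(\<Prod>(u, v)\<in>?F. y u * y v) = (\<Prod>(u, v)\<in>?F. y u) * (\<Prod>(u, v)\<in>?F. y v)"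
    by (simp add: case_prod_beta prod.distrib)
  also have "(\<Prod>(u, v)\<in>?F. y v) = (\<Prod>(u, v)\<in>?G. y u)"
    by (rule prod.reindex_bij_witness[where i = prod.swap and j = prod.swap]) auto
  also have "(\<Prod>(u, v)\<in>?F. y u) * (\<Prod>(u, v)\<in>?G. y u) = (\<Prod>(u, v)\<in>?F \<union> ?G. y u)"
    by (rule prod.union_disjoint[symmetric]) (use fin in auto)
  also have "?F \<union> ?G = Sigma K (\<lambda>u. K - {u})" by auto
  also have "(\<Prod>(u, v)\<in>Sigma K (\<lambda>u. K - {u}). y u) = (\<Prod>u\<in>K. \<Prod>v\<in>K - {u}. y u)"
    using K by (subst prod.Sigma) auto
  also have "\<dots> = (\<Prod>u\<in>K. y u ^ (card K - 1))"
    using K by simp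
  finally show ?thesis .
qed

text \<open>The exact value is 10; the crude bound 25 makes the sum of at most 25 terms, each at
  most 1/100, no larger than 1/4 in the next lemma.\<close>

lemma card_less_pairs_le:
  fixes K :: "nat set"
  assumes K: "card K = 5"
  shows "card {(u, v). u \<in> K \<and> v \<in> K \<and> u < v} \<le> 25"
proof -
  have "finite K" using K by (metis card.infinite zero_neq_numeral)
  then have "card {(u, v). u \<in> K \<and> v \<in> K \<and> u < v} \<le> card (K \<times> K)"
    by (intro card_mono) auto
  then show ?thesis using K by (simp add: card_cartesian_product)
qed

text \<open>For large \<open>d\<close> the second-order terms in \<open>1 - p powr (1/d) \<approx> -ln p / d\<close> and in \<open>S\<close>
  cost at most a quarter of the exponent.\<close>

lemma second_moment_bound_power_le:
  fixes p :: "'a \<Rightarrow> real"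
  assumes d: "0 < d" and F: "card F \<le> 25"
    and p: "\<And>e. e \<in> F \<Longrightarrow> 0 < p e \<and> p e \<le> 1 \<and> - ln (p e) \<le> real d / 100"
  defines "S \<equiv> \<Sum>e\<in>F. 1 - p e powr (1 / real d)"
  shows "(1 - S + S\<^sup>2 / 2) ^ d \<le> (\<Prod>e\<in>F. p e powr (3/4))"
proof -
  \<comment> \<open>Chosen so that \<open>p e powr (1 / real d) = exp (- x e)\<close>; then
    \<open>S\<close> is close to \<open>X\<close>, and \<open>d * X\<close> is the sum of the
    \<open>- ln (p e)\<close>.\<close>
  define x where "x e = - ln (p e) / real d" for e
  define X where "X = (\<Sum>e\<in>F. x e)"
  have x: "0 \<le> x e" "x e \<le> 1/100" if "e \<in> F" for e
    using p[OF that] d by (auto simp: x_def field_simps)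
  have pe: "p e powr (1 / real d) = exp (- x e)" if "e \<in> F" for e
    using p[OF that] by (simp add: x_def powr_def)
  have S: "S = (\<Sum>e\<in>F. 1 - exp (- x e))"
    unfolding S_def by (intro sum.cong) (simp_all add: pe)
  have lower: "99/100 * y \<le> 1 - exp (- y)" if "0 \<le> y" "y \<le> 1/100" for y :: real
  proof -
    have "exp (- y) \<le> 1 / (1 + y)"
      using exp_ge_add_one_self[of y] that by (simp add: exp_minus field_simps)
    also have "\<dots> \<le> 1 - 99/100 * y"
      using that mult_left_mono[OF that(2) that(1)] by (simp add: field_simps)
    finally show ?thesis by simp
  qed
  have "99/100 * X \<le> S"
    unfolding X_def S sum_distrib_left by (intro sum_mono lower x)
  moreover have "S \<le> X"
    unfolding X_def S
  proof (rule sum_mono)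
    fix e show "1 - exp (- x e) \<le> x e" using exp_ge_add_one_self[of "- x e"] by simp
  qed
  moreover have "X \<le> 1/4"
  proof -
    have "X \<le> (\<Sum>e\<in>F. 1/100)" unfolding X_def by (intro sum_mono x)
    then show ?thesis using F by simp
  qed
  moreover have "0 \<le> X" unfolding X_def by (intro sum_nonneg x)
  ultimately have "0 \<le> S" "S \<le> 1/4" by auto
  \<comment> \<open>The quadratic term costs at most \<open>S / 8\<close>, leaving slope 7/8 in
    \<open>S\<close>. Passing from \<open>S\<close> to \<open>X\<close> costs a factor 99/100, and
    7/8 * 99/100 still exceeds 3/4.\<close>
  then have "S\<^sup>2 \<le> S * (1/4)"
    unfolding power2_eq_square by (intro mult_left_mono)
  then have "1 - S + S\<^sup>2 / 2 \<le> 1 - 7/8 * S" using \<open>0 \<le> S\<close> by simp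
  also have "\<dots> \<le> 1 + - (3/4 * X)" using \<open>99/100 * X \<le> S\<close> \<open>0 \<le> X\<close> by simp
  also have "\<dots> \<le> exp (- (3/4 * X))" by (rule exp_ge_add_one_self)
  finally have "1 - S + S\<^sup>2 / 2 \<le> exp (- (3/4 * X))" .
  moreover have "0 \<le> 1 - S + S\<^sup>2 / 2"
    using \<open>S \<le> 1/4\<close> zero_le_power2[of S] by linarith
  ultimately have "(1 - S + S\<^sup>2 / 2) ^ d \<le> exp (- (3/4 * X)) ^ d"
    by (intro power_mono)
  also have "\<dots> = exp (\<Sum>e\<in>F. 3/4 * ln (p e))"
    using d by (simp add: X_def x_def exp_of_nat_mult[symmetric] sum_distrib_left sum_divide_distrib
        sum_negf field_simps)
  also have "\<dots> = (\<Prod>e\<in>F. p e powr (3/4))"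
  proof -
    have "exp (3/4 * ln (p e)) = p e powr (3/4)" if "e \<in> F" for e
      using p[OF that] by (simp add: powr_def)
    then show ?thesis
      by (cases "finite F") (simp_all add: exp_sum)
  qed
  finally show ?thesis .
qed

subsection \<open>The weight distribution\<close>

text \<open>For \<open>t \<ge> w0\<close> this is the exact Pareto tail with exponent
  \<open>1 - 3 = -2\<close>; for smaller \<open>t\<close> the right-hand side exceeds 1.\<close>

lemma weight_distr_tail:
  assumes w0: "0 < w0" and t: "0 < t"
  shows "measure (weight_distr 3 w0) {t<..} \<le> w0\<^sup>2 / t\<^sup>2"
proof -
  interpret W: real_distribution "weight_distr 3 w0"
    using w0 by (intro real_distribution_weight_distr) auto
  have "measure (weight_distr 3 w0) {t<..} = 1 - cdf (weight_distr 3 w0) t"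
    using W.prob_compl[of "{..t}"] by (simp add: cdf_def Compl_eq_Diff_UNIV[symmetric])
  also have "\<dots> \<le> w0\<^sup>2 / t\<^sup>2"
  proof (cases "t < w0")
    case True
    then have "t\<^sup>2 \<le> w0\<^sup>2" using t by (intro power_mono) auto
    then show ?thesis
      using True t w0 by (simp add: cdf_weight_distr pareto_cdf_def)
  next
    case False
    then show ?thesis
      using t w0 by (simp add: cdf_weight_distr pareto_cdf_def powr_minus powr_numeral
          power_divide inverse_eq_divide)
  qed
  finally show ?thesis .
qed

lemma AE_weight_distr_gt:
  assumes w0: "0 < w0"
  shows "AE w in weight_distr 3 w0. w0 < w"
proof -
  interpret W: real_distribution "weight_distr 3 w0"
    using w0 by (intro real_distribution_weight_distr) auto
  have "cdf (weight_distr 3 w0) w0 = 0"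
    using w0 by (simp add: cdf_weight_distr pareto_cdf_def)
  then have "{..w0} \<in> null_sets (weight_distr 3 w0)"
    by (simp add: cdf_def null_sets_def W.emeasure_eq_measure)
  then show ?thesis by (rule AE_I') auto
qed

text \<open>Write \<open>w ^ 3\<close> as the integral of \<open>3 * t\<^sup>2\<close> over
  \<open>0 \<le> t \<le> w\<close> and exchange the integrals. The tail bound
  \<open>w0\<^sup>2 / t\<^sup>2\<close> cancels \<open>t\<^sup>2\<close>, so the truncated third
  moment grows only linearly in \<open>M\<close>.\<close>

lemma nn_integral_weight_distr_cube_le:
  assumes w0: "0 < w0" and M: "0 \<le> M"
  shows "(\<integral>\<^sup>+w. ennreal (w ^ 3) * indicator {w0..M} w \<partial>weight_distr 3 w0) \<le> ennreal (3 * w0\<^sup>2 * M)"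
proof -
  define W where "W = weight_distr 3 w0"
  interpret W: real_distribution W
    unfolding W_def using w0 by (intro real_distribution_weight_distr) auto
  interpret pair_sigma_finite W lborel ..
  define h where "h w t = ennreal (3 * t\<^sup>2) * indicator {0..M} t * indicator {t<..} w" for w t :: real
  have h: "case_prod h \<in> borel_measurable (W \<Otimes>\<^sub>M lborel)"
  proof -
    have "case_prod h = (\<lambda>z. ennreal (3 * (snd z)\<^sup>2) * indicator {0..M} (snd z) *
        (if snd z < fst z then 1 else 0))"
      by (auto simp: h_def indicator_def)
    also have "\<dots> \<in> borel_measurable (borel \<Otimes>\<^sub>M borel)" by measurable
    finally show ?thesis
      by (simp cong: measurable_cong_sets sets_pair_measure_cong)
  qed
  have "ennreal (w ^ 3) * indicator {w0..M} w \<le> (\<integral>\<^sup>+t. h w t \<partial>lborel)" for w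
  proof (cases "w \<in> {w0..M}")
    case True
    then have w: "0 \<le> w" "w \<le> M" using w0 by auto
    have "(\<integral>\<^sup>+t. ennreal (3 * t\<^sup>2) * indicator {0..w} t \<partial>lborel) = ennreal (w ^ 3 - 0 ^ 3)"
      using w by (intro nn_integral_FTC_Icc) (auto intro!: derivative_eq_intros)
    then have "ennreal (w ^ 3) = (\<integral>\<^sup>+t. ennreal (3 * t\<^sup>2) * indicator {0..w} t \<partial>lborel)"
      by simp
    also have "\<dots> = (\<integral>\<^sup>+t. h w t \<partial>lborel)"
    proof (rule nn_integral_cong_AE)
      \<comment> \<open>\<open>h\<close> uses the strict condition \<open>t < w\<close>, to match
        the tail probability; it differs from the closed interval only at the null point
        \<open>t = w\<close>.\<close>
      have "AE t in lborel. t \<noteq> w" by (rule AE_lborel_singleton)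
      then show "AE t in lborel. ennreal (3 * t\<^sup>2) * indicator {0..w} t = h w t"
        by eventually_elim (use w in \<open>auto simp: h_def indicator_def\<close>)
    qed
    finally show ?thesis using True by simp
  qed simp
  then have "(\<integral>\<^sup>+w. ennreal (w ^ 3) * indicator {w0..M} w \<partial>W) \<le> (\<integral>\<^sup>+w. \<integral>\<^sup>+t. h w t \<partial>lborel \<partial>W)"
    by (intro nn_integral_mono)
  also have "\<dots> = (\<integral>\<^sup>+t. \<integral>\<^sup>+w. h w t \<partial>W \<partial>lborel)"
    using Fubini'[OF h] ..
  also have "\<dots> \<le> (\<integral>\<^sup>+t. ennreal (3 * w0\<^sup>2) * indicator {0..M} t \<partial>lborel)"
  proof (rule nn_integral_mono)
    fix t :: real
    have "(\<integral>\<^sup>+w. h w t \<partial>W) = ennreal (3 * t\<^sup>2) * indicator {0..M} t * emeasure W {t<..}"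
      unfolding h_def by (rule nn_integral_cmult_indicator) simp
    also have "\<dots> \<le> ennreal (3 * w0\<^sup>2) * indicator {0..M} t"
    proof (cases "0 < t \<and> t \<le> M")
      case True
      have "3 * t\<^sup>2 * measure W {t<..} \<le> 3 * t\<^sup>2 * (w0\<^sup>2 / t\<^sup>2)"
        unfolding W_def using True w0 by (intro mult_left_mono weight_distr_tail) auto
      then show ?thesis
        using True by (simp add: W.emeasure_eq_measure flip: ennreal_mult)
    next
      case False
      then show ?thesis by (cases "t = 0") (auto simp: indicator_def)
    qed
    finally show "(\<integral>\<^sup>+w. h w t \<partial>W) \<le> ennreal (3 * w0\<^sup>2) * indicator {0..M} t" .
  qed
  also have "\<dots> = ennreal (3 * w0\<^sup>2 * M)"
    using M by (subst nn_integral_cmult_indicator) (auto simp flip: ennreal_mult)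
  finally show ?thesis by (simp add: W_def)
qed

subsection \<open>Light and heavy vertices\<close>

definition girg_adj :: "real \<Rightarrow> nat \<Rightarrow> nat \<Rightarrow> (nat \<Rightarrow> real \<times> (nat \<Rightarrow> real)) \<Rightarrow> nat \<Rightarrow> nat \<Rightarrow> bool" where
  "girg_adj lam n d s u v \<longleftrightarrow> torus_dist d (snd (s u)) (snd (s v))
     \<le> 1/2 * (lam * fst (s u) * fst (s v) / real n) powr (1 / real d)"

lemma girg_adj_commute: "girg_adj lam n d s u v \<longleftrightarrow> girg_adj lam n d s v u"
  by (simp add: girg_adj_def torus_dist_def circ_dist_commute[of "snd (s u) _"] mult_ac)

lemma girg_edges_iff:
  "{u, v} \<in> girg_edges lam n d s \<longleftrightarrow> u < n \<and> v < n \<and> u \<noteq> v \<and> girg_adj lam n d s u v"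
  unfolding girg_edges_def using girg_adj_commute
  by (auto simp: girg_adj_def doubleton_eq_iff)

lemma measurable_girg_weight:
  assumes "v < n"
  shows "(\<lambda>s. fst (s v)) \<in> borel_measurable (girg n \<beta> w0 d)"
proof -
  have "(\<lambda>s. s v) \<in> girg n \<beta> w0 d \<rightarrow>\<^sub>M weight_distr \<beta> w0 \<Otimes>\<^sub>M torus_distr d"
    unfolding girg_def using assms by (intro measurable_component_singleton) auto
  from measurable_fst'[OF this] show ?thesis
    by (simp add: weight_distr_def cong: measurable_cong_sets)
qed

lemma measurable_girg_position:
  assumes "v < n" "i < d"
  shows "(\<lambda>s. snd (s v) i) \<in> borel_measurable (girg n \<beta> w0 d)"
proof -
  have "(\<lambda>s. s v) \<in> girg n \<beta> w0 d \<rightarrow>\<^sub>M weight_distr \<beta> w0 \<Otimes>\<^sub>M torus_distr d"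
    unfolding girg_def using assms by (intro measurable_component_singleton) auto
  note measurable_snd'[OF this]
  moreover have "(\<lambda>x. x i) \<in> torus_distr d \<rightarrow>\<^sub>M unif01"
    unfolding torus_distr_def using assms by (intro measurable_component_singleton) auto
  ultimately have "(\<lambda>s. snd (s v) i) \<in> girg n \<beta> w0 d \<rightarrow>\<^sub>M unif01"
    by (rule measurable_compose)
  then show ?thesis by (simp cong: measurable_cong_sets)
qed

lemma measurable_girg_adj:
  assumes "u < n" "v < n"
  shows "Measurable.pred (girg n \<beta> w0 d) (\<lambda>s. girg_adj lam n d s u v)"
proof -
  have "(\<lambda>s. torus_dist d (snd (s u)) (snd (s v))) \<in> borel_measurable (girg n \<beta> w0 d)"
    unfolding torus_dist_def circ_dist_def using assms measurable_girg_position
    by (intro borel_measurable_Max) auto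
  moreover have "(\<lambda>s. 1/2 * (lam * fst (s u) * fst (s v) / real n) powr (1 / real d))
      \<in> borel_measurable (girg n \<beta> w0 d)"
    using assms by (intro borel_measurable_times borel_measurable_divide powr_real_measurable
        borel_measurable_const measurable_girg_weight)
  ultimately show ?thesis
    unfolding girg_adj_def pred_def by (rule borel_measurable_le)
qed

section \<open>Light 5-cliques\<close>

text \<open>The condition \<open>u < v\<close> lists each unordered pair once, as the Bonferroni
  bound over pairs requires.\<close>

definition light_clique ::
  "real \<Rightarrow> nat \<Rightarrow> nat \<Rightarrow> real \<Rightarrow> nat set \<Rightarrow> (nat \<Rightarrow> real \<times> (nat \<Rightarrow> real)) \<Rightarrow> bool" where
  "light_clique lam n d M K s \<longleftrightarrow> (\<forall>v\<in>K. fst (s v) \<le> M) \<and>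
     (\<forall>u\<in>K. \<forall>v\<in>K. u < v \<longrightarrow> girg_adj lam n d s u v)"

lemma sets_light_clique:
  assumes "K \<subseteq> {..<n}"
  shows "{s \<in> space (girg n \<beta> w0 d). light_clique lam n d M K s} \<in> sets (girg n \<beta> w0 d)"
proof -
  have K: "finite K" "\<And>v. v \<in> K \<Longrightarrow> v < n"
    using assms by (auto intro: finite_subset)
  have "Measurable.pred (girg n \<beta> w0 d) (\<lambda>s. fst (s v) \<le> M)" if "v \<in> K" for v
    using measurable_girg_weight[OF K(2)[OF that], of \<beta> w0 d] by measurable
  then have "Measurable.pred (girg n \<beta> w0 d) (\<lambda>s. light_clique lam n d M K s)"
    unfolding light_clique_def using K
    by (intro pred_intros_logic(3,4) pred_intros_finite(3) measurable_girg_adj) auto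
  then show ?thesis by (simp only: pred_def)
qed

lemma torus_dist_le_iff:
  assumes "0 < d"
  shows "torus_dist d x y \<le> t \<longleftrightarrow> (\<forall>i<d. circ_dist (x i) (y i) \<le> t)"
proof -
  have "{..<d} \<noteq> {}" using assms by auto
  then show ?thesis unfolding torus_dist_def by (subst Max_le_iff) auto
qed

text \<open>Given the weights, the clique condition must hold in each of \<open>d\<close>
  independent coordinates, and the one-coordinate bound is raised to the power \<open>d\<close>. For
  light weights \<open>small\<close> ensures \<open>p \<le> 1\<close>, and \<open>large\<close>
  ensures \<open>- ln p \<le> real d / 100\<close>. The resulting product over vertices is then
  integrated weight by weight.\<close>

lemma emeasure_light_clique_le:
  assumes lam: "0 < lam" and w0: "0 < w0" and d: "0 < d" and n: "0 < n" and M: "0 \<le> M"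
    and K: "K \<subseteq> {..<n}" "card K = 5"
    and small: "lam * M\<^sup>2 \<le> real n" and large: "ln (real n / (lam * w0\<^sup>2)) \<le> real d / 100"
  shows "emeasure (girg n 3 w0 d) {s \<in> space (girg n 3 w0 d). light_clique lam n d M K s}
    \<le> ennreal ((3 * sqrt (lam / real n) ^ 3 * w0\<^sup>2 * M) ^ 5)"
proof -
  define G where "G = girg n 3 w0 d"
  define W where "W = weight_distr 3 w0"
  define P where "P = (\<Pi>\<^sub>M v\<in>{..<n}. unif01)"
  define F where "F = {(u, v). u \<in> K \<and> v \<in> K \<and> u < v}"
  define p where "p w e = lam * w (fst e) * w (snd e) / real n" for w :: "nat \<Rightarrow> real" and e
  define C where "C w = {z \<in> space P. \<forall>e\<in>F. circ_dist (z (fst e)) (z (snd e)) \<le> 1/2 * p w e powr (1 / real d)}" for w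
  \<comment> \<open>The square root splits a pair into its endpoints:
    \<open>p w (u, v) = y (w u) * y (w v)\<close>.\<close>
  define y where "y w = sqrt (lam / real n) * w" for w
  \<comment> \<open>The value 1 outside \<open>K\<close> allows a product over all \<open>n\<close>
    vertices, as the product measure requires; those factors integrate to 1.\<close>
  define \<phi> where "\<phi> v w = (if v \<in> K then ennreal (y w ^ 3) * indicator {w0..M} w else 1)" for v :: nat and w
  interpret W: real_distribution W
    unfolding W_def using w0 by (intro real_distribution_weight_distr) auto
  interpret P: prob_space P unfolding P_def by (intro prob_space_PiM prob_space_unif01)
  interpret PW: product_sigma_finite "\<lambda>_::nat. W" by standard
  have T: "sigma_finite_measure (torus_distr d)"
    by (intro prob_space_imp_sigma_finite prob_space_torus_distr)
  have U: "sigma_finite_measure unif01"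
    by (intro prob_space_imp_sigma_finite prob_space_unif01)
  have finK: "finite K" using K by (metis card.infinite zero_neq_numeral)
  have "F \<subseteq> K \<times> K" by (auto simp: F_def)
  then have finF: "finite F" using finK by (metis finite_SigmaI finite_subset)
  let ?A = "{s \<in> space G. light_clique lam n d M K s}"
  have A[measurable]: "?A \<in> sets G"
    unfolding G_def by (rule sets_light_clique[OF K(1)])
  have comp: "(\<lambda>z. z i) \<in> borel_measurable P" if "i < n" for i
    using measurable_component_singleton[of i "{..<n}" "\<lambda>_. unif01"] that
    by (simp add: P_def cong: measurable_cong_sets)
  have C: "C w \<in> sets P" for w
  proof -
    have "Measurable.pred P (\<lambda>z. circ_dist (z (fst e)) (z (snd e)) \<le> 1/2 * p w e powr (1 / real d))"
      if "e \<in> F" for e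
    proof -
      have "fst e < n" "snd e < n" using that K by (auto simp: F_def)
      from this[THEN comp] show ?thesis unfolding circ_dist_def by measurable
    qed
    then have "Measurable.pred P
        (\<lambda>z. \<forall>e\<in>F. circ_dist (z (fst e)) (z (snd e)) \<le> 1/2 * p w e powr (1 / real d))"
      by (intro pred_intros_finite(3) finF)
    then show ?thesis by (simp only: pred_def C_def)
  qed
  \<comment> \<open>The left-hand side is the conditional probability of the clique given the
    weights \<open>w\<close>. If some vertex of \<open>K\<close> is heavy, it is 0.\<close>
  have cond: "(\<integral>\<^sup>+x. indicator ?A (\<lambda>v\<in>{..<n}. (w v, x v)) \<partial>(\<Pi>\<^sub>M v\<in>{..<n}. torus_distr d))
      \<le> (\<Prod>v<n. \<phi> v (w v))" (is "?L w \<le> _")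
    if w: "\<forall>v<n. w0 < w v" for w
  proof (cases "\<forall>v\<in>K. w v \<le> M")
    case False
    then have "(\<lambda>v\<in>{..<n}. (w v, x v)) \<notin> ?A" for x
      using K by (auto simp: light_clique_def)
    then show ?thesis by simp
  next
    case True
    have wK: "0 < w v" "w0 \<le> w v" "w v \<le> M" if "v \<in> K" for v
      using that True w K w0 by (auto intro: less_trans less_imp_le)
    have yK: "0 < y (w v)" if "v \<in> K" for v
      using wK[OF that] lam n by (simp add: y_def)
    have p: "0 < p w e" "p w e \<le> 1" "- ln (p w e) \<le> real d / 100" if "e \<in> F" for e
    proof -
      have e: "fst e \<in> K" "snd e \<in> K" using that by (auto simp: F_def)
      note wK[OF e(1)] wK[OF e(2)]
      then show pos: "0 < p w e" using lam n by (simp add: p_def)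
      have "w (fst e) * w (snd e) \<le> M * M"
        using wK[OF e(1)] wK[OF e(2)] M by (intro mult_mono) auto
      then have "lam * (w (fst e) * w (snd e)) \<le> lam * M\<^sup>2"
        using lam by (simp add: power2_eq_square)
      with small have "lam * (w (fst e) * w (snd e)) \<le> real n" by (rule order_trans[rotated])
      then show "p w e \<le> 1" using n by (simp add: p_def mult.assoc)
      have "w0 * w0 \<le> w (fst e) * w (snd e)"
        using wK[OF e(1)] wK[OF e(2)] w0 by (intro mult_mono) auto
      then have "lam * w0\<^sup>2 / real n \<le> p w e"
        using lam n by (simp add: p_def power2_eq_square mult.assoc divide_right_mono)
      then have "ln (lam * w0\<^sup>2 / real n) \<le> ln (p w e)"
        using lam w0 n pos by (intro ln_mono) auto
      then show "- ln (p w e) \<le> real d / 100"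
        using large lam w0 n by (simp add: ln_div)
    qed
    \<comment> \<open>Adjacency bounds a maximum over coordinates, so the clique event puts every
      column \<open>i\<close> of the position matrix into the same set \<open>C w\<close>.\<close>
    have "?L w \<le> (\<integral>\<^sup>+x. (\<Prod>i\<in>{..<d}. indicator (C w) (\<lambda>v\<in>{..<n}. x v i)) \<partial>(\<Pi>\<^sub>M v\<in>{..<n}. torus_distr d))"
    proof (rule nn_integral_mono)
      fix x
      show "indicator ?A (\<lambda>v\<in>{..<n}. (w v, x v)) \<le> (\<Prod>i\<in>{..<d}. indicator (C w) (\<lambda>v\<in>{..<n}. x v i) :: ennreal)"
      proof (cases "(\<lambda>v\<in>{..<n}. (w v, x v)) \<in> ?A")
        case in_A: True
        have "(\<lambda>v\<in>{..<n}. x v i) \<in> C w" if "i < d" for i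
        proof -
          have "circ_dist (x u i) (x v i) \<le> 1/2 * p w (u, v) powr (1 / real d)"
            if "(u, v) \<in> F" for u v
          proof -
            have uv: "u \<in> K" "v \<in> K" "u < v" "u < n" "v < n" using that K by (auto simp: F_def)
            with in_A have "girg_adj lam n d (\<lambda>v\<in>{..<n}. (w v, x v)) u v"
              by (auto simp: light_clique_def)
            then show ?thesis
              unfolding girg_adj_def torus_dist_le_iff[OF d] using uv \<open>i < d\<close> by (simp add: p_def)
          qed
          moreover have "u < n" "v < n" if "(u, v) \<in> F" for u v
            using that K by (auto simp: F_def)
          ultimately show ?thesis
            by (auto simp: C_def P_def space_PiM)
        qed
        then show ?thesis using in_A by simp
      qed simp
    qed
    also have "\<dots> = (\<Prod>i\<in>{..<d}. \<integral>\<^sup>+z. indicator (C w) z \<partial>P)"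
      unfolding torus_distr_def P_def
      by (rule nn_integral_PiM_PiM_prod[OF U]) (use C in \<open>auto simp: P_def\<close>)
    also have "\<dots> = ennreal (measure P (C w) ^ d)"
      using C by (simp add: P.emeasure_eq_measure ennreal_power)
    also have "\<dots> \<le> ennreal (\<Prod>e\<in>F. p w e powr (3/4))"
    proof (rule ennreal_leI)
      define S where "S = (\<Sum>e\<in>F. 1 - p w e powr (1 / real d))"
      have "measure P (C w) \<le> 1 - (\<Sum>e\<in>F. 1 - 2 * (1/2 * p w e powr (1 / real d)))
          + (\<Sum>e\<in>F. 1 - 2 * (1/2 * p w e powr (1 / real d)))\<^sup>2 / 2"
        unfolding C_def P_def
      proof (rule prob_PiM_unif01_all_circ_dist_le)
        show "u \<in> {..<n} \<and> v \<in> {..<n} \<and> u < v" if "(u, v) \<in> F" for u v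
          using that K by (auto simp: F_def)
        show "0 \<le> 1/2 * p w e powr (1 / real d) \<and> 1/2 * p w e powr (1 / real d) \<le> 1/2"
          if "e \<in> F" for e
          using powr_le1[of "1 / real d" "p w e"] p[OF that] by simp
      qed simp
      then have "measure P (C w) \<le> 1 - S + S\<^sup>2 / 2" by (simp add: S_def)
      then have "measure P (C w) ^ d \<le> (1 - S + S\<^sup>2 / 2) ^ d"
        by (intro power_mono) auto
      also have "\<dots> \<le> (\<Prod>e\<in>F. p w e powr (3/4))"
        unfolding S_def using p card_less_pairs_le[OF K(2)]
        by (intro second_moment_bound_power_le[OF d]) (auto simp: F_def)
      finally show "measure P (C w) ^ d \<le> (\<Prod>e\<in>F. p w e powr (3/4))" .
    qed
    also have "(\<Prod>e\<in>F. p w e powr (3/4)) = (\<Prod>v\<in>K. y (w v) ^ 3)"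
    proof -
      have "(\<Prod>e\<in>F. p w e powr (3/4)) = (\<Prod>(u, v)\<in>F. y (w u) powr (3/4) * y (w v) powr (3/4))"
      proof (intro prod.cong refl, clarify)
        fix u v assume "(u, v) \<in> F"
        then have uv: "u \<in> K" "v \<in> K" by (auto simp: F_def)
        have "p w (u, v) = y (w u) * y (w v)"
        proof -
          have "y (w u) * y (w v) = (sqrt (lam / real n) * sqrt (lam / real n)) * (w u * w v)"
            by (simp only: y_def mult_ac)
          then show ?thesis using lam n by (simp add: p_def)
        qed
        then show "p w (u, v) powr (3/4) = y (w u) powr (3/4) * y (w v) powr (3/4)"
          using yK[OF uv(1)] yK[OF uv(2)] by (simp add: powr_mult)
      qed
      \<comment> \<open>Each of the five vertices lies in four pairs, and 4 * 3/4 = 3 gives the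
        cube. This is why cliques of size 5 are counted: the loss of a quarter in the exponent still
        leaves a third moment.\<close>
      also have "\<dots> = (\<Prod>v\<in>K. (y (w v) powr (3/4)) ^ (card K - 1))"
        unfolding F_def by (rule prod_less_pairs[OF finK])
      also have "\<dots> = (\<Prod>v\<in>K. y (w v) ^ 3)"
      proof (intro prod.cong refl)
        fix v assume "v \<in> K"
        have "(y (w v) powr (3/4)) ^ (card K - 1) = y (w v) powr 3"
          using yK[OF \<open>v \<in> K\<close>] K by (simp add: powr_power)
        then show "(y (w v) powr (3/4)) ^ (card K - 1) = y (w v) ^ 3"
          using yK[OF \<open>v \<in> K\<close>] by (simp add: powr_numeral)
      qed
      finally show ?thesis .
    qed
    also have "ennreal (\<Prod>v\<in>K. y (w v) ^ 3) = (\<Prod>v\<in>K. ennreal (y (w v) ^ 3))"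
      using yK by (intro prod_ennreal[symmetric]) (auto intro: less_imp_le)
    also have "\<dots> = (\<Prod>v\<in>K. \<phi> v (w v))"
      using wK by (intro prod.cong) (auto simp: \<phi>_def)
    also have "\<dots> = (\<Prod>v<n. \<phi> v (w v))"
      using K by (intro prod.mono_neutral_left) (auto simp: \<phi>_def)
    finally show ?thesis .
  qed
  have \<phi>_meas: "\<phi> v \<in> borel_measurable W" for v
    unfolding \<phi>_def y_def by (cases "v \<in> K") simp_all
  have \<phi>_le: "(\<integral>\<^sup>+w. \<phi> v w \<partial>W) \<le> ennreal (3 * sqrt (lam / real n) ^ 3 * w0\<^sup>2 * M)" if "v \<in> K" for v
  proof -
    have "(\<integral>\<^sup>+w. \<phi> v w \<partial>W) = (\<integral>\<^sup>+w. ennreal (sqrt (lam / real n) ^ 3) * (ennreal (w ^ 3) * indicator {w0..M} w) \<partial>W)"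
      using that lam w0 by (intro nn_integral_cong)
        (auto simp: \<phi>_def y_def power_mult_distrib ennreal_mult indicator_def)
    also have "\<dots> = ennreal (sqrt (lam / real n) ^ 3) * (\<integral>\<^sup>+w. ennreal (w ^ 3) * indicator {w0..M} w \<partial>W)"
      by (rule nn_integral_cmult) simp
    also have "\<dots> \<le> ennreal (sqrt (lam / real n) ^ 3) * ennreal (3 * w0\<^sup>2 * M)"
      unfolding W_def by (intro mult_left_mono nn_integral_weight_distr_cube_le w0 M) simp
    also have "\<dots> = ennreal (3 * sqrt (lam / real n) ^ 3 * w0\<^sup>2 * M)"
      using lam M by (simp add: mult_ac flip: ennreal_mult)
    finally show ?thesis .
  qed
  have "AE w in W. w0 < w"
    unfolding W_def by (rule AE_weight_distr_gt[OF w0])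
  then have AE: "AE w in (\<Pi>\<^sub>M v\<in>{..<n}. W). \<forall>v\<in>{..<n}. w0 < w v"
    by (intro AE_finite_allI AE_PiM_component W.prob_space_axioms) auto
  have "emeasure G ?A = (\<integral>\<^sup>+s. indicator ?A s \<partial>G)" by simp
  also have "\<dots> = (\<integral>\<^sup>+w. ?L w \<partial>(\<Pi>\<^sub>M v\<in>{..<n}. W))"
    using A unfolding G_def girg_def W_def[symmetric]
    by (intro nn_integral_PiM_pair W.sigma_finite_measure_axioms T) auto
  also have "\<dots> \<le> (\<integral>\<^sup>+w. (\<Prod>v<n. \<phi> v (w v)) \<partial>(\<Pi>\<^sub>M v\<in>{..<n}. W))"
    by (intro nn_integral_mono_AE, use AE in eventually_elim) (rule cond, simp)
  also have "\<dots> = (\<Prod>v<n. \<integral>\<^sup>+w. \<phi> v w \<partial>W)"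
    by (rule PW.product_nn_integral_prod) (auto simp: \<phi>_meas)
  also have "\<dots> = (\<Prod>v\<in>K. \<integral>\<^sup>+w. \<phi> v w \<partial>W)"
    using K W.emeasure_space_1 by (intro prod.mono_neutral_right) (auto simp: \<phi>_def)
  also have "\<dots> \<le> (\<Prod>v\<in>K. ennreal (3 * sqrt (lam / real n) ^ 3 * w0\<^sup>2 * M))"
    by (intro prod_mono_ennreal \<phi>_le)
  also have "\<dots> = ennreal ((3 * sqrt (lam / real n) ^ 3 * w0\<^sup>2 * M) ^ 5)"
    using K lam M by (simp add: ennreal_power)
  finally show ?thesis by (simp add: G_def)
qed

section \<open>The number of heavy vertices\<close>

lemma prob_girg_weight_gt_le:
  assumes w0: "0 < w0" and M: "0 < M" and v: "v < n"
  shows "measure (girg n 3 w0 d) {s \<in> space (girg n 3 w0 d). M < fst (s v)} \<le> w0\<^sup>2 / M\<^sup>2"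
proof -
  define W where "W = weight_distr 3 w0"
  define T where "T = torus_distr d"
  interpret W: real_distribution W
    unfolding W_def using w0 by (intro real_distribution_weight_distr) auto
  interpret T: prob_space T unfolding T_def by (rule prob_space_torus_distr)
  have pair: "prob_space (W \<Otimes>\<^sub>M T)"
    by (intro prob_space_pair W.prob_space_axioms T.prob_space_axioms)
  have G: "girg n 3 w0 d = (\<Pi>\<^sub>M v\<in>{..<n}. W \<Otimes>\<^sub>M T)" by (simp add: girg_def W_def T_def)
  have B: "{M<..} \<times> space T \<in> sets (W \<Otimes>\<^sub>M T)" by (intro pair_measureI) auto
  have "emeasure W {M<..} = emeasure (W \<Otimes>\<^sub>M T) ({M<..} \<times> space T)"
    by (subst T.emeasure_pair_measure_Times) (auto simp: T.emeasure_space_1)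
  also have "\<dots> = emeasure (distr (girg n 3 w0 d) (W \<Otimes>\<^sub>M T) (\<lambda>s. s v)) ({M<..} \<times> space T)"
    unfolding G using v by (subst distr_PiM_component) (auto simp: pair)
  also have "\<dots> = emeasure (girg n 3 w0 d) ((\<lambda>s. s v) -` ({M<..} \<times> space T) \<inter> space (girg n 3 w0 d))"
    unfolding G using v B by (intro emeasure_distr measurable_component_singleton) auto
  also have "(\<lambda>s. s v) -` ({M<..} \<times> space T) \<inter> space (girg n 3 w0 d) =
      {s \<in> space (girg n 3 w0 d). M < fst (s v)}"
  proof -
    have "snd (s v) \<in> space T" if "s \<in> space (girg n 3 w0 d)" for s
      using that v by (simp add: G space_PiM space_pair_measure PiE_iff mem_Times_iff)
    then show ?thesis by (auto simp: mem_Times_iff)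
  qed
  finally have "measure (girg n 3 w0 d) {s \<in> space (girg n 3 w0 d). M < fst (s v)} = measure W {M<..}"
    by (simp add: measure_def)
  then show ?thesis using weight_distr_tail[OF w0 M] by (simp add: W_def)
qed

text \<open>Markov's inequality for the number of heavy vertices, whose expectation is bounded by
  linearity.\<close>

lemma prob_girg_many_heavy_le:
  assumes w0: "0 < w0" and M: "0 < M" and a: "0 < a"
  shows "measure (girg n 3 w0 d) {s \<in> space (girg n 3 w0 d). a \<le> real (card {v\<in>{..<n}. M < fst (s v)})}
    \<le> real n * (w0\<^sup>2 / M\<^sup>2) / a"
proof -
  define G where "G = girg n 3 w0 d"
  interpret G: prob_space G unfolding G_def using w0 by (intro prob_space_girg) auto
  define H where "H v = {s \<in> space G. M < fst (s v)}" for v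
  have H[measurable]: "H v \<in> sets G" if "v < n" for v
    unfolding H_def G_def using measurable_girg_weight[OF that, of 3 w0 d] by measurable
  have card: "real (card {v\<in>{..<n}. M < fst (s v)}) = (\<Sum>v<n. indicator (H v) s)" if "s \<in> space G" for s
    using that by (simp add: H_def indicator_def sum.If_cases Int_def)
  have int: "integrable G (\<lambda>s. \<Sum>v<n. indicat_real (H v) s)"
    using H by (auto simp: G.emeasure_eq_measure)
  have "measure G {s \<in> space G. a \<le> real (card {v\<in>{..<n}. M < fst (s v)})}
      = measure G {s \<in> space G. a \<le> (\<Sum>v<n. indicator (H v) s)}"
    by (intro arg_cong[where f = "measure G"] Collect_cong conj_cong refl) (simp only: card)
  also have "\<dots> \<le> (\<integral>s. (\<Sum>v<n. indicator (H v) s) \<partial>G) / a"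
    by (rule integral_Markov_inequality_measure[OF int _ _ a, of "{}"]) (auto intro!: sum_nonneg)
  also have "(\<integral>s. (\<Sum>v<n. indicator (H v) s) \<partial>G) = (\<Sum>v<n. measure G (H v))"
    using H by (subst Bochner_Integration.integral_sum) (auto simp: G.emeasure_eq_measure)
  also have "\<dots> \<le> (\<Sum>v<n. w0\<^sup>2 / M\<^sup>2)"
    unfolding H_def G_def by (intro sum_mono prob_girg_weight_gt_le w0 M) auto
  finally show ?thesis using a by (simp add: G_def divide_right_mono)
qed

section \<open>From light and heavy vertices to the clique number\<close>

text \<open>Take a maximum clique. Either five of its vertices are light and form a light clique, or
  at most four are light and all the others are heavy, hence \<open>a - 4\<close>.\<close>

lemma girg_clique_number_ge_cases:
  assumes "a \<le> real (girg_clique_number lam n d s)"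
  shows "a - 4 \<le> real (card {v\<in>{..<n}. M < fst (s v)}) \<or>
    (\<exists>K. K \<subseteq> {..<n} \<and> card K = 5 \<and> light_clique lam n d M K s)"
proof -
  let ?E = "girg_edges lam n d s"
  have "finite {card K | K. is_clique {..<n} ?E K}"
    by (rule finite_subset[of _ "card ` Pow {..<n}"]) (auto simp: is_clique_def)
  \<comment> \<open>The empty clique makes the set of sizes nonempty, so that \<open>Max\<close> is
    attained.\<close>
  moreover have "is_clique {..<n} ?E {}" by (simp add: is_clique_def)
  then have "{card K | K. is_clique {..<n} ?E K} \<noteq> {}" by blast
  ultimately have "girg_clique_number lam n d s \<in> {card K | K. is_clique {..<n} ?E K}"
    unfolding girg_clique_number_def clique_number_def by (rule Max_in)
  then obtain K where K: "is_clique {..<n} ?E K" and card: "girg_clique_number lam n d s = card K"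
    by auto
  have adj: "girg_adj lam n d s u v" if "u \<in> K" "v \<in> K" "u < v" for u v
  proof -
    have "{u, v} \<in> ?E" using K that by (auto simp: is_clique_def)
    then show ?thesis by (simp only: girg_edges_iff)
  qed
  have sub: "K \<subseteq> {..<n}" using K by (simp add: is_clique_def)
  then have fin: "finite K" by (auto intro: finite_subset)
  define L where "L = {v\<in>K. fst (s v) \<le> M}"
  show ?thesis
  proof (cases "5 \<le> card L")
    case True
    then obtain K' where K': "K' \<subseteq> L" "card K' = 5"
      by (meson obtain_subset_with_card_n)
    then have "light_clique lam n d M K' s"
      using adj by (auto simp: light_clique_def L_def subset_iff)
    moreover have "K' \<subseteq> {..<n}" using K' sub by (auto simp: L_def)
    ultimately show ?thesis using K' by blast
  next
    case False
    have "card K = card L + card {v\<in>K. M < fst (s v)}"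
      using fin by (subst card_Un_disjoint[symmetric]) (auto simp: L_def intro!: arg_cong[where f = card])
    also have "card {v\<in>K. M < fst (s v)} \<le> card {v\<in>{..<n}. M < fst (s v)}"
      using sub by (intro card_mono) auto
    finally have "real (card K) \<le> 4 + real (card {v\<in>{..<n}. M < fst (s v)})"
      using False by linarith
    then show ?thesis using assms card by linarith
  qed
qed

text \<open>The two summands come from Markov's inequality for heavy vertices and a union bound over
  all 5-subsets. Both are free of \<open>n\<close> and \<open>d\<close>, which is the reason for the
  threshold \<open>c * sqrt (real n)\<close>.\<close>

lemma prob_girg_clique_number_ge_le:
  assumes lam: "0 < lam" and w0: "0 < w0" and d: "0 < d" and n: "0 < n" and c: "0 < c" and a: "4 < a"
    and small: "lam * c\<^sup>2 \<le> 1" and large: "ln (real n / (lam * w0\<^sup>2)) \<le> real d / 100"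
  shows "\<P>(s in girg n 3 w0 d. a \<le> real (girg_clique_number lam n d s))
    \<le> w0\<^sup>2 / c\<^sup>2 / (a - 4) + (3 * sqrt lam ^ 3 * w0\<^sup>2 * c) ^ 5"
proof -
  define G where "G = girg n 3 w0 d"
  interpret G: prob_space G unfolding G_def using w0 by (intro prob_space_girg) auto
  define M where "M = c * sqrt (real n)"
  have M: "0 < M" using c n by (simp add: M_def)
  have M2: "M\<^sup>2 = c\<^sup>2 * real n" by (simp add: M_def power_mult_distrib)
  define Ks where "Ks = {K. K \<subseteq> {..<n} \<and> card K = 5}"
  define Lc where "Lc K = {s \<in> space G. light_clique lam n d M K s}" for K
  define Hv where "Hv = {s \<in> space G. a - 4 \<le> real (card {v\<in>{..<n}. M < fst (s v)})}"
  define q where "q = (3 * sqrt (lam / real n) ^ 3 * w0\<^sup>2 * M) ^ 5"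
  have fin: "finite Ks" unfolding Ks_def by (rule finite_subset[of _ "Pow {..<n}"]) auto
  have Lc: "Lc K \<in> sets G" if "K \<in> Ks" for K
    using that unfolding Lc_def G_def Ks_def by (intro sets_light_clique) auto
  have Hv: "Hv \<in> sets G"
  proof -
    have "Hv = {s \<in> space G. a - 4 \<le> (\<Sum>v<n. indicat_real {M<..} (fst (s v)))}"
      unfolding Hv_def by (simp add: indicator_def sum.If_cases Int_def)
    moreover have "(\<lambda>s. \<Sum>v<n. indicat_real {M<..} (fst (s v))) \<in> borel_measurable G"
      unfolding G_def
      by (intro borel_measurable_sum measurable_compose[OF measurable_girg_weight]) auto
    ultimately show ?thesis by simp
  qed
  have "lam * M\<^sup>2 \<le> real n"
    using mult_right_mono[OF small, of "real n"] by (simp add: M2 mult.assoc)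
  then have Lc_le: "measure G (Lc K) \<le> q" if "K \<in> Ks" for K
  proof -
    have "emeasure G (Lc K) \<le> ennreal q"
      unfolding G_def Lc_def q_def using that \<open>lam * M\<^sup>2 \<le> real n\<close>
      by (intro emeasure_light_clique_le lam w0 d n less_imp_le[OF M] large) (auto simp: Ks_def)
    moreover have "0 \<le> q" using lam M by (simp add: q_def)
    ultimately show ?thesis by (simp add: G.emeasure_eq_measure)
  qed
  have "measure G {s \<in> space G. a \<le> real (girg_clique_number lam n d s)} \<le> measure G (Hv \<union> (\<Union>K\<in>Ks. Lc K))"
  proof (rule G.finite_measure_mono)
    show "{s \<in> space G. a \<le> real (girg_clique_number lam n d s)} \<subseteq> Hv \<union> (\<Union>K\<in>Ks. Lc K)"
      using girg_clique_number_ge_cases[of a lam n d _ M] by (auto simp: Hv_def Lc_def Ks_def)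
    show "Hv \<union> (\<Union>K\<in>Ks. Lc K) \<in> sets G"
      using Hv Lc fin by auto
  qed
  also have "\<dots> \<le> measure G Hv + measure G (\<Union>K\<in>Ks. Lc K)"
    using Hv Lc fin by (intro measure_Un_le) auto
  also have "measure G (\<Union>K\<in>Ks. Lc K) \<le> (\<Sum>K\<in>Ks. measure G (Lc K))"
    using Lc fin by (intro measure_UNION_le) auto
  also have "\<dots> \<le> real (card Ks) * q"
    using sum_mono[OF Lc_le] by simp
  also have "real (card Ks) * q \<le> real n ^ 5 * q"
  proof -
    have "card Ks = n choose 5"
      unfolding Ks_def using n_subsets[of "{..<n}" 5] by simp
    also have "n choose 5 \<le> n ^ 5"
      by (cases "5 \<le> n") (auto simp: binomial_le_pow binomial_eq_0)
    finally have "card Ks \<le> n ^ 5" .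
    then have "real (card Ks) \<le> real n ^ 5"
      by (metis of_nat_le_iff of_nat_power)
    then show ?thesis using lam M by (intro mult_right_mono) (auto simp: q_def)
  qed
  also have "real n ^ 5 * q = (3 * sqrt lam ^ 3 * w0\<^sup>2 * c) ^ 5"
  proof -
    \<comment> \<open>Per vertex, the powers of \<open>n\<close> cancel: 1 from the choice of the
      vertex, -3/2 from the cube, 1/2 from the truncation \<open>M\<close>.\<close>
    have "real n * (sqrt (lam / real n) ^ 3 * sqrt (real n)) = sqrt lam ^ 3"
      using n by (simp add: real_sqrt_divide power_divide power3_eq_cube)
    then have "real n * (3 * sqrt (lam / real n) ^ 3 * w0\<^sup>2 * M) = 3 * sqrt lam ^ 3 * w0\<^sup>2 * c"
      by (simp add: M_def mult_ac)
    then show ?thesis by (simp only: q_def flip: power_mult_distrib)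
  qed
  also have "measure G Hv \<le> real n * (w0\<^sup>2 / M\<^sup>2) / (a - 4)"
    unfolding Hv_def G_def using a by (intro prob_girg_many_heavy_le w0 M) auto
  also have "real n * (w0\<^sup>2 / M\<^sup>2) = w0\<^sup>2 / c\<^sup>2"
    using n by (simp add: M2)
  finally show ?thesis by (simp add: G_def)
qed

theorem theorem31:
  fixes lam w0 :: real and d :: "nat \<Rightarrow> nat" and f :: "nat \<Rightarrow> real"
  assumes "lam > 0" and "w0 > 0"
    and "(\<lambda>n. real (d n)) \<in> \<omega>(\<lambda>n. ln (real n))"
    and "filterlim f at_top sequentially"
  shows "(\<lambda>n. \<P>(s in girg n 3 w0 (d n). real (girg_clique_number lam n (d n) s) \<ge> f n))
           \<in> o(\<lambda>_. 1)"
proof -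
  \<comment> \<open>This is the bound above with \<open>c = x powr (-1/4)\<close>. Then
    \<open>c\<close> tends to 0, which kills the light term, while the heavy term is of order
    \<open>x powr (-1/2)\<close>.\<close>
  define b where "b x = w0\<^sup>2 / (x powr (-1/4))\<^sup>2 / (x - 4) + (3 * sqrt lam ^ 3 * w0\<^sup>2 * x powr (-1/4)) ^ 5"
    for x :: real
  have "(b \<longlongrightarrow> 0) at_top"
    unfolding b_def using assms(1,2) by real_asymp
  then have b: "((\<lambda>n. b (f n)) \<longlongrightarrow> 0) sequentially"
    by (rule filterlim_compose[OF _ assms(4)])
  have "eventually (\<lambda>x. lam * (x powr (-1/4))\<^sup>2 \<le> 1) at_top"
    using assms(1) by real_asymp
  then have "eventually (\<lambda>x. lam * (x powr (-1/4))\<^sup>2 \<le> 1 \<and> 4 < x) at_top"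
    using eventually_gt_at_top[of 4] by eventually_elim simp
  then have ev_f: "eventually (\<lambda>n. lam * (f n powr (-1/4))\<^sup>2 \<le> 1 \<and> 4 < f n) sequentially"
    by (rule eventually_compose_filterlim[OF _ assms(4)])
  \<comment> \<open>Half of the factor 200 absorbs \<open>ln (real n)\<close> and the other half the
    constant \<open>- ln (lam * w0\<^sup>2)\<close>, leaving the required
    \<open>real (d n) / 100\<close>. Together with \<open>0 < ln (real n)\<close> it also gives
    \<open>0 < d n\<close>.\<close>
  have "eventually (\<lambda>n. 200 * norm (ln (real n)) \<le> norm (real (d n))) sequentially"
    using assms(3) by (rule landau_omega.smallD) simp
  then have ev_d: "eventually (\<lambda>n. 200 * \<bar>ln (real n)\<bar> \<le> real (d n)) sequentially"
    by simp
  have ev_n: "eventually (\<lambda>n. 0 < ln (real n) \<and> - ln (lam * w0\<^sup>2) \<le> ln (real n)) sequentially"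
    by (intro eventually_conj) real_asymp+
  have "eventually (\<lambda>n. \<P>(s in girg n 3 w0 (d n). real (girg_clique_number lam n (d n) s) \<ge> f n)
      \<le> b (f n)) sequentially"
    using ev_f ev_d ev_n eventually_gt_at_top[of 0]
  proof eventually_elim
    case (elim n)
    have "ln (real n / (lam * w0\<^sup>2)) = ln (real n) - ln (lam * w0\<^sup>2)"
      using elim assms(1,2) by (simp add: ln_div)
    also have "\<dots> \<le> real (d n) / 100" using elim by linarith
    finally have large: "ln (real n / (lam * w0\<^sup>2)) \<le> real (d n) / 100" .
    have "0 < real (d n)" using elim by linarith
    then show ?case
      unfolding b_def using elim assms(1,2) large
      by (intro prob_girg_clique_number_ge_le) auto
  qed
  then have "((\<lambda>n. \<P>(s in girg n 3 w0 (d n). real (girg_clique_number lam n (d n) s) \<ge> f n)) \<longlongrightarrow> 0) sequentially"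
    by (intro tendsto_sandwich[OF _ _ tendsto_const b]) auto
  then show ?thesis by (intro smalloI_tendsto) simp_all
qed

end
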